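(* Let $G$ be a finitely generated amenable group, or a finitely generated right-angled Artin group. Then a central extension of $G$ by a finitely generated torsion-free abelian group is quasi-isometrically trivial if and only if it is virtually trivial.
   Context: Finitely generated groups are endowed with word metrics with respect to finite generating sets. A central extension $1\to Z\to E\xrightarrow{\pi} G\to 1$ with $G,Z$ (hence $E$) finitely generated is quasi-isometrically trivial if there is a quasi-isometry $f\colon E\to Z\times G$ such that $\sup_{h\in E} d_G(\pi(h),\pi_2(f(h)))<+\infty$, where $d_G$ is a word metric on $G$ and $\pi_2\colon Z\times G\to G$ is the projection on the second factor. The central extension is virtually trivial if there exists a finite-index subgroup $G'$ of $G$ such that the induced central extension $1\to Z\to \pi^{-1}(G')\xrightarrow{\pi} G'\to 1$ is trivial, i.e. isomorphic as a central extension to the product extension $Z\times G'$ (equivalently, its Euler class in $H^2(G',Z)$ vanishes). *)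

theory Defs
  imports Complex_Main "HOL-Algebra.Generated_Groups"
begin

section \<open>Finitely generated groups and word metrics\<close>

definition finite_generating_set :: "('a, 'm) monoid_scheme \<Rightarrow> 'a set \<Rightarrow> bool" where
  "finite_generating_set G S \<longleftrightarrow> finite S \<and> S \<subseteq> carrier G \<and> generate G S = carrier G"

definition finitely_generated_group :: "('a, 'm) monoid_scheme \<Rightarrow> bool" where
  "finitely_generated_group G \<longleftrightarrow> group G \<and> (\<exists>S. finite_generating_set G S)"

definition word_length :: "('a, 'm) monoid_scheme \<Rightarrow> 'a set \<Rightarrow> 'a \<Rightarrow> nat" where
  "word_length G S g =
     (LEAST n. \<exists>ws. length ws = n \<and> set ws \<subseteq> S \<union> (\<lambda>s. inv\<^bsub>G\<^esub> s) ` S \<and>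
                    foldr (\<lambda>x y. x \<otimes>\<^bsub>G\<^esub> y) ws \<one>\<^bsub>G\<^esub> = g)"

definition word_dist :: "('a, 'm) monoid_scheme \<Rightarrow> 'a set \<Rightarrow> 'a \<Rightarrow> 'a \<Rightarrow> real" where
  "word_dist G S g h = real (word_length G S (inv\<^bsub>G\<^esub> g \<otimes>\<^bsub>G\<^esub> h))"

definition quasi_isometry ::
    "'a set \<Rightarrow> ('a \<Rightarrow> 'a \<Rightarrow> real) \<Rightarrow> 'b set \<Rightarrow> ('b \<Rightarrow> 'b \<Rightarrow> real) \<Rightarrow> ('a \<Rightarrow> 'b) \<Rightarrow> bool" where
  "quasi_isometry M d1 N d2 f \<longleftrightarrow>
     f \<in> M \<rightarrow> N \<and>
     (\<exists>K C. K \<ge> 1 \<and> C \<ge> 0 \<and>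
        (\<forall>x\<in>M. \<forall>x'\<in>M. d1 x x' / K - C \<le> d2 (f x) (f x') \<and> d2 (f x) (f x') \<le> K * d1 x x' + C) \<and>
        (\<forall>y\<in>N. \<exists>x\<in>M. d2 (f x) y \<le> C))"

section \<open>Central extensions\<close>

definition central_extension ::
    "('z, 'k) monoid_scheme \<Rightarrow> ('e, 'l) monoid_scheme \<Rightarrow> ('g, 'm) monoid_scheme \<Rightarrow>
     ('z \<Rightarrow> 'e) \<Rightarrow> ('e \<Rightarrow> 'g) \<Rightarrow> bool" where
  "central_extension Z E G \<iota> \<pi> \<longleftrightarrow>
     group Z \<and> group E \<and> group G \<and>
     \<iota> \<in> hom Z E \<and> inj_on \<iota> (carrier Z) \<and>
     \<pi> \<in> hom E G \<and> \<pi> ` carrier E = carrier G \<and>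
     \<iota> ` carrier Z = kernel E G \<pi> \<and>
     (\<forall>z\<in>carrier Z. \<forall>h\<in>carrier E. \<iota> z \<otimes>\<^bsub>E\<^esub> h = h \<otimes>\<^bsub>E\<^esub> \<iota> z)"

definition extension_isomorphic ::
    "('z, 'k) monoid_scheme \<Rightarrow> ('e, 'l) monoid_scheme \<Rightarrow> ('z \<Rightarrow> 'e) \<Rightarrow> ('e \<Rightarrow> 'g) \<Rightarrow>
     ('f, 'n) monoid_scheme \<Rightarrow> ('z \<Rightarrow> 'f) \<Rightarrow> ('f \<Rightarrow> 'g) \<Rightarrow> bool" where
  "extension_isomorphic Z E \<iota> \<pi> E' \<iota>' \<pi>' \<longleftrightarrow>
     (\<exists>\<Phi> \<in> iso E E'. (\<forall>z\<in>carrier Z. \<Phi> (\<iota> z) = \<iota>' z) \<and> (\<forall>h\<in>carrier E. \<pi>' (\<Phi> h) = \<pi> h))"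

definition trivial_extension ::
    "('z, 'k) monoid_scheme \<Rightarrow> ('e, 'l) monoid_scheme \<Rightarrow> ('g, 'm) monoid_scheme \<Rightarrow>
     ('z \<Rightarrow> 'e) \<Rightarrow> ('e \<Rightarrow> 'g) \<Rightarrow> bool" where
  "trivial_extension Z E G \<iota> \<pi> \<longleftrightarrow>
     extension_isomorphic Z E \<iota> \<pi> (Z \<times>\<times> G) (\<lambda>z. (z, \<one>\<^bsub>G\<^esub>)) snd"

definition virtually_trivial ::
    "('z, 'k) monoid_scheme \<Rightarrow> ('e, 'l) monoid_scheme \<Rightarrow> ('g, 'm) monoid_scheme \<Rightarrow>
     ('z \<Rightarrow> 'e) \<Rightarrow> ('e \<Rightarrow> 'g) \<Rightarrow> bool" where
  "virtually_trivial Z E G \<iota> \<pi> \<longleftrightarrow>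
     (\<exists>G'. subgroup G' G \<and> finite (rcosets\<^bsub>G\<^esub> G') \<and>
        trivial_extension Z (E\<lparr>carrier := {h \<in> carrier E. \<pi> h \<in> G'}\<rparr>) (G\<lparr>carrier := G'\<rparr>) \<iota> \<pi>)"

text \<open>The sets \<open>SE\<close>, \<open>SZG\<close> and \<open>SG\<close> are finite generating sets of \<open>E\<close>, \<open>Z \<times>\<times> G\<close> and \<open>G\<close>;
  they serve only to fix word metrics on these groups.\<close>

definition quasi_isometrically_trivial ::
    "('z, 'k) monoid_scheme \<Rightarrow> ('e, 'l) monoid_scheme \<Rightarrow> ('g, 'm) monoid_scheme \<Rightarrow> ('e \<Rightarrow> 'g) \<Rightarrow>
     'e set \<Rightarrow> ('z \<times> 'g) set \<Rightarrow> 'g set \<Rightarrow> bool" where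
  "quasi_isometrically_trivial Z E G \<pi> SE SZG SG \<longleftrightarrow>
     (\<exists>f. quasi_isometry (carrier E) (word_dist E SE)
            (carrier (Z \<times>\<times> G)) (word_dist (Z \<times>\<times> G) SZG) f \<and>
          bdd_above ((\<lambda>h. word_dist G SG (\<pi> h) (snd (f h))) ` carrier E))"

definition torsion_free_group :: "('a, 'm) monoid_scheme \<Rightarrow> bool" where
  "torsion_free_group G \<longleftrightarrow>
     group G \<and> (\<forall>g\<in>carrier G. \<forall>n::nat. n > 0 \<longrightarrow> g [^]\<^bsub>G\<^esub> n = \<one>\<^bsub>G\<^esub> \<longrightarrow> g = \<one>\<^bsub>G\<^esub>)"

section \<open>Amenable groups\<close>

definition bounded_functions :: "('a, 'm) monoid_scheme \<Rightarrow> ('a \<Rightarrow> real) set" where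
  "bounded_functions G = {f. \<exists>B. \<forall>x\<in>carrier G. \<bar>f x\<bar> \<le> B}"

text \<open>Functions are total, but additivity and positivity force \<open>m f\<close> to depend only on the
  restriction of \<open>f\<close> to the carrier, so \<open>m\<close> is a mean on the bounded functions on the group.\<close>

definition left_invariant_mean :: "('a, 'm) monoid_scheme \<Rightarrow> (('a \<Rightarrow> real) \<Rightarrow> real) \<Rightarrow> bool" where
  "left_invariant_mean G m \<longleftrightarrow>
     (\<forall>f\<in>bounded_functions G. \<forall>g\<in>bounded_functions G. m (\<lambda>x. f x + g x) = m f + m g) \<and>
     (\<forall>c. \<forall>f\<in>bounded_functions G. m (\<lambda>x. c * f x) = c * m f) \<and>
     (\<forall>f\<in>bounded_functions G. (\<forall>x\<in>carrier G. 0 \<le> f x) \<longrightarrow> 0 \<le> m f) \<and>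
     m (\<lambda>x. 1) = 1 \<and>
     (\<forall>a\<in>carrier G. \<forall>f\<in>bounded_functions G. m (\<lambda>x. f (a \<otimes>\<^bsub>G\<^esub> x)) = m f)"

definition amenable_group :: "('a, 'm) monoid_scheme \<Rightarrow> bool" where
  "amenable_group G \<longleftrightarrow> group G \<and> (\<exists>m. left_invariant_mean G m)"

section \<open>Group presentations and right-angled Artin groups\<close>

text \<open>The letter \<open>(x, True)\<close> stands for the generator \<open>x\<close> and \<open>(x, False)\<close> for its formal inverse.\<close>

type_synonym 'v gword = "('v \<times> bool) list"

definition gwords :: "'v set \<Rightarrow> 'v gword set" where
  "gwords V = lists (V \<times> UNIV)"

inductive word_step :: "'v set \<Rightarrow> 'v gword set \<Rightarrow> 'v gword \<Rightarrow> 'v gword \<Rightarrow> bool"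
  for V :: "'v set" and R :: "'v gword set" where
  cancel: "u \<in> gwords V \<Longrightarrow> w \<in> gwords V \<Longrightarrow> x \<in> V \<Longrightarrow>
             word_step V R (u @ [(x, b), (x, \<not> b)] @ w) (u @ w)"
| relator: "u \<in> gwords V \<Longrightarrow> w \<in> gwords V \<Longrightarrow> r \<in> R \<Longrightarrow> word_step V R (u @ r @ w) (u @ w)"

definition word_rel :: "'v set \<Rightarrow> 'v gword set \<Rightarrow> ('v gword \<times> 'v gword) set" where
  "word_rel V R = {(u, w). u \<in> gwords V \<and> w \<in> gwords V \<and> equivclp (word_step V R) u w}"

text \<open>The group presented by generators \<open>V\<close> and relators \<open>R \<subseteq> gwords V\<close>.\<close>

definition presented_group :: "'v set \<Rightarrow> 'v gword set \<Rightarrow> 'v gword set monoid" where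
  "presented_group V R =
     \<lparr>carrier = gwords V // word_rel V R,
      mult = (\<lambda>A B. \<Union>u\<in>A. \<Union>w\<in>B. word_rel V R `` {u @ w}),
      one = word_rel V R `` {[]}\<rparr>"

definition simplicial_graph :: "'v set \<Rightarrow> 'v set set \<Rightarrow> bool" where
  "simplicial_graph V Ed \<longleftrightarrow> (\<forall>e\<in>Ed. e \<subseteq> V \<and> card e = 2)"

definition raag_relators :: "'v set set \<Rightarrow> 'v gword set" where
  "raag_relators Ed =
     {[(x, True), (y, True), (x, False), (y, False)] | x y. {x, y} \<in> Ed}"

definition raag :: "'v set \<Rightarrow> 'v set set \<Rightarrow> 'v gword set monoid" where
  "raag V Ed = presented_group V (raag_relators Ed)"

section \<open>Basic properties\<close>

lemma finitely_generated_extension: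
  assumes ext: "central_extension Z E G \<iota> \<pi>"
    and Z: "finitely_generated_group Z" and G: "finitely_generated_group G"
  shows "finitely_generated_group E"
proof -
  from ext interpret E: group E by (simp add: central_extension_def)
  from ext interpret G: group G by (simp add: central_extension_def)
  from ext interpret Z: group Z by (simp add: central_extension_def)
  from ext interpret p: group_hom E G \<pi>
    by unfold_locales (simp add: central_extension_def)
  from ext interpret i: group_hom Z E \<iota>
    by unfold_locales (simp add: central_extension_def)
  obtain S where S: "finite S" "S \<subseteq> carrier Z" "generate Z S = carrier Z"
    using Z by (auto simp: finitely_generated_group_def finite_generating_set_def)
  obtain T where T: "finite T" "T \<subseteq> carrier G" "generate G T = carrier G"
    using G by (auto simp: finitely_generated_group_def finite_generating_set_def)
  have sur: "\<pi> ` carrier E = carrier G" and ker: "\<iota> ` carrier Z = kernel E G \<pi>"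
    using ext by (auto simp: central_extension_def)
  obtain T' where T': "finite T'" "T' \<subseteq> carrier E" "\<pi> ` T' = T"
    using finite_subset_image[of T \<pi> "carrier E"] T sur by metis
  define U where "U = \<iota> ` S \<union> T'"
  have U: "U \<subseteq> carrier E" "finite U" using S T' by (auto simp: U_def)
  interpret H: subgroup "generate E U" E using E.generate_is_subgroup[OF U(1)] .
  have 1: "\<iota> ` carrier Z \<subseteq> generate E U"
    using i.generate_img[OF S(2)] S(3) E.mono_generate[of "\<iota> ` S" U] by (auto simp: U_def)
  have 2: "\<pi> ` generate E U = carrier G"
  proof
    show "\<pi> ` generate E U \<subseteq> carrier G" using H.subset by auto
    have "generate G T = \<pi> ` generate E T'" using p.generate_img[OF T'(2)] T' by simp
    also have "\<dots> \<subseteq> \<pi> ` generate E U" using E.mono_generate[of T' U] by (auto simp: U_def)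
    finally show "carrier G \<subseteq> \<pi> ` generate E U" using T by simp
  qed
  have "h \<in> generate E U" if h: "h \<in> carrier E" for h
  proof -
    obtain k where k: "k \<in> generate E U" "\<pi> k = \<pi> h" using 2 h
      by (metis imageE p.hom_closed)
    have kc: "k \<in> carrier E" using k H.subset by auto
    have "inv\<^bsub>E\<^esub> k \<otimes>\<^bsub>E\<^esub> h \<in> kernel E G \<pi>"
      using h k kc by (simp add: kernel_def)
    then have "inv\<^bsub>E\<^esub> k \<otimes>\<^bsub>E\<^esub> h \<in> generate E U" using ker 1 by auto
    then have "k \<otimes>\<^bsub>E\<^esub> (inv\<^bsub>E\<^esub> k \<otimes>\<^bsub>E\<^esub> h) \<in> generate E U" using k by auto
    then show ?thesis using h kc by (simp add: E.m_assoc[symmetric])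
  qed
  then have "generate E U = carrier E" using H.subset by auto
  then show ?thesis using U E.group_axioms
    by (auto simp: finitely_generated_group_def finite_generating_set_def)
qed

lemma equiv_word_rel: "equiv (gwords V) (word_rel V R)"
proof (rule equivI)
  show "word_rel V R \<subseteq> gwords V \<times> gwords V" by (auto simp: word_rel_def)
  show "refl_on (gwords V) (word_rel V R)" by (auto simp: refl_on_def word_rel_def)
  show "sym (word_rel V R)" by (auto simp: sym_def word_rel_def intro: equivclp_sym)
  show "trans (word_rel V R)" by (auto simp: trans_def word_rel_def intro: equivclp_trans)
qed

lemma gwords_append [simp]: "u @ w \<in> gwords V \<longleftrightarrow> u \<in> gwords V \<and> w \<in> gwords V"
  by (simp add: gwords_def)

lemma word_step_append:
  assumes "word_step V R u u'" "v \<in> gwords V" "w \<in> gwords V"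
  shows "word_step V R (v @ u @ w) (v @ u' @ w)"
  using assms(1)
proof cases
  case (cancel u1 w1 x b)
  then show ?thesis
    using word_step.cancel[of "v @ u1" V "w1 @ w" x R b] assms by simp
next
  case (relator u1 w1 r)
  then show ?thesis
    using word_step.relator[of "v @ u1" V "w1 @ w" r R] assms by simp
qed

lemma equivclp_word_step_append:
  assumes "equivclp (word_step V R) u u'" "v \<in> gwords V" "w \<in> gwords V"
  shows "equivclp (word_step V R) (v @ u @ w) (v @ u' @ w)"
  using assms(1)
proof (induction rule: equivclp_induct)
  case base
  then show ?case by simp
next
  case (step y z)
  then have "word_step V R (v @ y @ w) (v @ z @ w) \<or> word_step V R (v @ z @ w) (v @ y @ w)"
    using word_step_append[OF _ assms(2,3)] by metis
  with step(3) show ?case by (metis equivclp_into_equivclp)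
qed

lemma word_rel_append:
  assumes "(u, u') \<in> word_rel V R" "(w, w') \<in> word_rel V R"
  shows "(u @ w, u' @ w') \<in> word_rel V R"
proof -
  have "equivclp (word_step V R) ([] @ u @ w) ([] @ u' @ w)"
    using assms by (intro equivclp_word_step_append) (auto simp: word_rel_def gwords_def)
  moreover have "equivclp (word_step V R) (u' @ w @ []) (u' @ w' @ [])"
    using assms by (intro equivclp_word_step_append) (auto simp: word_rel_def gwords_def)
  ultimately have "equivclp (word_step V R) (u @ w) (u' @ w')"
    by (auto intro: equivclp_trans)
  then show ?thesis using assms by (simp add: word_rel_def)
qed

lemma presented_group_mult:
  assumes "u \<in> gwords V" "w \<in> gwords V"
  shows "word_rel V R `` {u} \<otimes>\<^bsub>presented_group V R\<^esub> word_rel V R `` {w} = word_rel V R `` {u @ w}"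
proof -
  let ?q = "word_rel V R"
  have eq: "?q `` {u' @ w'} = ?q `` {u @ w}"
    if "u' \<in> ?q `` {u}" "w' \<in> ?q `` {w}" for u' w'
  proof -
    have "(u @ w, u' @ w') \<in> ?q" using that by (intro word_rel_append) auto
    then show ?thesis using equiv_class_eq[OF equiv_word_rel] by metis
  qed
  have self: "u \<in> ?q `` {u}" "w \<in> ?q `` {w}"
    using assms equiv_class_self[OF equiv_word_rel] by metis+
  have "?q `` {u} \<otimes>\<^bsub>presented_group V R\<^esub> ?q `` {w} = (\<Union>u'\<in>?q `` {u}. \<Union>w'\<in>?q `` {w}. ?q `` {u' @ w'})"
    by (simp add: presented_group_def)
  also have "\<dots> = (\<Union>u'\<in>?q `` {u}. \<Union>w'\<in>?q `` {w}. ?q `` {u @ w})"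
    using eq by (intro SUP_cong refl)
  also have "\<dots> = ?q `` {u @ w}"
    using self by (metis UN_constant empty_iff)
  finally show ?thesis .
qed

lemma word_inverse:
  assumes "w \<in> gwords V"
  shows "(rev (map (\<lambda>(x, b). (x, \<not> b)) w) @ w, []) \<in> word_rel V R"
proof -
  have "equivclp (word_step V R) (rev (map (\<lambda>(x, b). (x, \<not> b)) w) @ w) []" 
    using assms
  proof (induction w)
    case Nil
    then show ?case by simp
  next
    case (Cons a w)
    obtain x b where a: "a = (x, b)" by force
    let ?r = "rev (map (\<lambda>(x, b). (x, \<not> b)) w)"
    have w: "w \<in> gwords V" "x \<in> V" using Cons.prems a by (auto simp: gwords_def)
    then have r: "?r \<in> gwords V" by (auto simp: gwords_def in_lists_conv_set)
    have "word_step V R (?r @ [(x, \<not> b), (x, \<not> \<not> b)] @ w) (?r @ w)"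
      using r w by (intro word_step.cancel)
    then have "equivclp (word_step V R) (rev (map (\<lambda>(x, b). (x, \<not> b)) (a # w)) @ a # w) (?r @ w)"
      by (simp add: a r_into_equivclp)
    with Cons.IH[OF w(1)] show ?case by (blast intro: equivclp_trans)
  qed
  moreover have "rev (map (\<lambda>(x, b). (x, \<not> b)) w) \<in> gwords V"
    using assms by (auto simp: gwords_def in_lists_conv_set)
  ultimately show ?thesis using assms by (simp add: word_rel_def gwords_def)
qed

lemma group_presented_group: "group (presented_group V R)"
proof (rule groupI)
  let ?P = "presented_group V R"
  have car: "A \<in> carrier ?P \<longleftrightarrow> (\<exists>u\<in>gwords V. A = word_rel V R `` {u})" for A
    by (auto simp: presented_group_def quotient_def)
  have one: "\<one>\<^bsub>?P\<^esub> = word_rel V R `` {[]}" and nil: "[] \<in> gwords V"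
    by (auto simp: presented_group_def gwords_def)
  show "\<one>\<^bsub>?P\<^esub> \<in> carrier ?P" using one nil car by blast
  fix A assume A: "A \<in> carrier ?P"
  then obtain u where u: "u \<in> gwords V" "A = word_rel V R `` {u}" using car by auto
  show "\<one>\<^bsub>?P\<^esub> \<otimes>\<^bsub>?P\<^esub> A = A" using u nil by (simp add: one presented_group_mult)
  let ?r = "rev (map (\<lambda>(x, b). (x, \<not> b)) u)"
  have r: "?r \<in> gwords V" using word_inverse[OF u(1), of R] by (simp add: word_rel_def)
  have "word_rel V R `` {?r} \<otimes>\<^bsub>?P\<^esub> A = \<one>\<^bsub>?P\<^esub>"
    using u r equiv_class_eq[OF equiv_word_rel word_inverse[OF u(1), of R]]
    by (simp add: presented_group_mult one)
  then show "\<exists>B\<in>carrier ?P. B \<otimes>\<^bsub>?P\<^esub> A = \<one>\<^bsub>?P\<^esub>" using r car by blast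
  fix B assume "B \<in> carrier ?P"
  then obtain v where v: "v \<in> gwords V" "B = word_rel V R `` {v}" using car by auto
  show "A \<otimes>\<^bsub>?P\<^esub> B \<in> carrier ?P" using u v car by (auto simp: presented_group_mult)
  fix C assume "C \<in> carrier ?P"
  then obtain w where w: "w \<in> gwords V" "C = word_rel V R `` {w}" using car by auto
  show "A \<otimes>\<^bsub>?P\<^esub> B \<otimes>\<^bsub>?P\<^esub> C = A \<otimes>\<^bsub>?P\<^esub> (B \<otimes>\<^bsub>?P\<^esub> C)" using u v w
    by (simp add: presented_group_mult)
qed

lemma group_raag: "group (raag V Ed)"
  by (simp add: raag_def group_presented_group)

end

theory Submission
  imports Defs "HOL-Algebra.Multiplicative_Group"
begin

text \<open>Both sides are compared with the existence of a coarse section: a map \<open>s\<close> from \<open>G\<close> to \<open>E\<close> over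
  the identity such that \<open>s(g)\<inverse> s(gt)\<close> takes finitely many values for each fixed \<open>t\<close>. For every
  central extension this is equivalent to quasi-isometric triviality, and it follows from virtual
  triviality.

  Given a coarse section, write \<open>h = s(\<pi>(h)) \<iota>(z)\<close> and compose \<open>h \<mapsto> z\<close> with an additive function
  \<open>l\<close> on \<open>Z\<close>. The resulting function on \<open>E\<close> has bounded increments under right multiplication by a
  fixed element. If \<open>G\<close> is amenable, averaging these increments extends \<open>l\<close> to a homomorphism from
  \<open>E\<close> to the reals, so \<open>\<iota>(Z)\<close> meets the derived subgroup of \<open>E\<close> trivially and has a virtual
  complement. If \<open>G\<close> is a right-angled Artin group, comparing \<open>x\<^sup>n y\<^sup>n\<close> with \<open>y\<^sup>n x\<^sup>n\<close> shows that lifts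
  of commuting elements commute, so lifts of the standard generators define a splitting.\<close>

section \<open>Word metrics\<close>

text \<open>Some restriction on \<open>G\<close> is unavoidable for passing from a coarse section to
  a virtual splitting: a bounded integral cocycle yields a coarse section, and the fundamental group
  of the unit tangent bundle of a closed hyperbolic surface is such an extension although it splits
  over no finite-index subgroup. The coordinate along the fibres is controlled only for one right
  factor at a time, which is less than a quasimorphism gives, so homogenisation is not at hand;
  averaging and the comparison of quadratic with linear growth are the two substitutes.

  Finite generation and torsion-freeness of \<open>Z\<close> enter through integer-valued additive
  functions: they separate each nontrivial element from \<open>1\<close>, so a single integer
  coordinate suffices.

  A finite-index subgroup is really needed for amenable \<open>G\<close>: the integers as an
  extension of the group of order two by the even integers do not split, yet they split over the
  trivial subgroup. For right-angled Artin groups the splitting found is over all of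
  \<open>G\<close>.\<close>

context group
begin

lemma inv_mult_cancel [simp]:
  assumes "x \<in> carrier G" "y \<in> carrier G"
  shows "inv x \<otimes> (x \<otimes> y) = y" "x \<otimes> (inv x \<otimes> y) = y"
  using assms by (simp_all add: m_assoc[symmetric])

lemma inv_mult_mult_inv:
  assumes "x \<in> carrier G" "y \<in> carrier G" "z \<in> carrier G"
  shows "inv x \<otimes> z \<otimes> inv (inv y \<otimes> z) = inv x \<otimes> y"
  using assms by (simp add: inv_mult_group m_assoc)

lemma foldr_mult_closed:
  "set ws \<subseteq> carrier G \<Longrightarrow> foldr (\<lambda>x y. x \<otimes> y) ws \<one> \<in> carrier G"
  by (induction ws) auto

lemma foldr_mult_append:
  assumes "set us \<subseteq> carrier G" "set ws \<subseteq> carrier G"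
  shows "foldr (\<lambda>x y. x \<otimes> y) (us @ ws) \<one>
           = foldr (\<lambda>x y. x \<otimes> y) us \<one> \<otimes> foldr (\<lambda>x y. x \<otimes> y) ws \<one>"
  using assms by (induction us) (auto simp: m_assoc foldr_mult_closed simp del: foldr_append)

lemma generate_imp_word:
  assumes "S \<subseteq> carrier G" "g \<in> generate G S"
  shows "\<exists>ws. set ws \<subseteq> S \<union> (\<lambda>s. inv s) ` S \<and> foldr (\<lambda>x y. x \<otimes> y) ws \<one> = g"
  using assms(2)
proof induction
  case one
  show ?case by (rule exI[of _ "[]"]) simp
next
  case (incl h)
  with assms(1) show ?case by (intro exI[of _ "[h]"]) auto
next
  case (inv h)
  with assms(1) show ?case by (intro exI[of _ "[inv h]"]) auto
next
  case (eng g h)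
  then obtain us ws where us: "set us \<subseteq> S \<union> (\<lambda>s. inv s) ` S" "foldr (\<lambda>x y. x \<otimes> y) us \<one> = g"
    and ws: "set ws \<subseteq> S \<union> (\<lambda>s. inv s) ` S" "foldr (\<lambda>x y. x \<otimes> y) ws \<one> = h" by blast
  have "S \<union> (\<lambda>s. inv s) ` S \<subseteq> carrier G" using assms(1) by auto
  then have "foldr (\<lambda>x y. x \<otimes> y) (us @ ws) \<one> = g \<otimes> h"
    using us ws foldr_mult_append[of us ws] by (metis subset_trans)
  with us ws show ?case by (intro exI[of _ "us @ ws"]) auto
qed

lemma word_length_witness:
  assumes "finite_generating_set G S" "g \<in> carrier G"
  obtains ws where "length ws = word_length G S g" "set ws \<subseteq> S \<union> (\<lambda>s. inv s) ` S"
    "foldr (\<lambda>x y. x \<otimes> y) ws \<one> = g"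
proof -
  let ?P = "\<lambda>n. \<exists>ws. length ws = n \<and> set ws \<subseteq> S \<union> (\<lambda>s. inv s) ` S \<and> foldr (\<lambda>x y. x \<otimes> y) ws \<one> = g"
  have "\<exists>n. ?P n"
    using generate_imp_word[of S g] assms by (auto simp: finite_generating_set_def)
  then have "?P (word_length G S g)" unfolding word_length_def by (rule LeastI_ex)
  then show ?thesis using that by blast
qed

lemma word_length_le:
  assumes "set ws \<subseteq> S \<union> (\<lambda>s. inv s) ` S"
  shows "word_length G S (foldr (\<lambda>x y. x \<otimes> y) ws \<one>) \<le> length ws"
  unfolding word_length_def by (rule Least_le) (use assms in blast)

lemma word_length_one: "word_length G S \<one> = 0"
  using word_length_le[of "[]" S] by simp

lemma word_length_mult_le:
  assumes S: "finite_generating_set G S" and gh: "g \<in> carrier G" "h \<in> carrier G"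
  shows "word_length G S (g \<otimes> h) \<le> word_length G S g + word_length G S h"
proof -
  obtain us where us: "length us = word_length G S g" "set us \<subseteq> S \<union> (\<lambda>s. inv s) ` S"
    "foldr (\<lambda>x y. x \<otimes> y) us \<one> = g" using word_length_witness[OF S gh(1)] .
  obtain ws where ws: "length ws = word_length G S h" "set ws \<subseteq> S \<union> (\<lambda>s. inv s) ` S"
    "foldr (\<lambda>x y. x \<otimes> y) ws \<one> = h" using word_length_witness[OF S gh(2)] .
  have c: "S \<union> (\<lambda>s. inv s) ` S \<subseteq> carrier G" using S by (auto simp: finite_generating_set_def)
  have "word_length G S (foldr (\<lambda>x y. x \<otimes> y) (us @ ws) \<one>) \<le> length (us @ ws)"
    using us ws by (intro word_length_le) auto
  moreover have "foldr (\<lambda>x y. x \<otimes> y) (us @ ws) \<one> = g \<otimes> h"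
    using us ws c foldr_mult_append[of us ws] by (metis subset_trans)
  ultimately show ?thesis using us ws by simp
qed

lemma finite_word_ball:
  assumes "finite_generating_set G S"
  shows "finite {g \<in> carrier G. real (word_length G S g) \<le> r}"
proof (rule finite_subset)
  let ?A = "S \<union> (\<lambda>s. inv s) ` S"
  show "finite ((\<lambda>ws. foldr (\<lambda>x y. x \<otimes> y) ws \<one>) ` {ws. set ws \<subseteq> ?A \<and> length ws \<le> nat \<lfloor>r\<rfloor>})"
    using assms by (intro finite_imageI finite_lists_length_le) (auto simp: finite_generating_set_def)
  show "{g \<in> carrier G. real (word_length G S g) \<le> r} \<subseteq> \<dots>"
  proof
    fix g assume "g \<in> {g \<in> carrier G. real (word_length G S g) \<le> r}"
    then have g: "g \<in> carrier G" "word_length G S g \<le> nat \<lfloor>r\<rfloor>" by (auto simp: le_nat_floor)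
    obtain ws where "length ws = word_length G S g" "set ws \<subseteq> ?A" "foldr (\<lambda>x y. x \<otimes> y) ws \<one> = g"
      using word_length_witness[OF assms g(1)] .
    with g show "g \<in> (\<lambda>ws. foldr (\<lambda>x y. x \<otimes> y) ws \<one>) ` {ws. set ws \<subseteq> ?A \<and> length ws \<le> nat \<lfloor>r\<rfloor>}"
      by (intro image_eqI[of _ _ ws]) auto
  qed
qed

text \<open>This turns metric bounds into finiteness of sets of quotients, and
  \<open>word_dist_lipschitz\<close> goes the other way; between the two the arguments are purely
  algebraic.\<close>

lemma finite_word_dist_ball:
  assumes "finite_generating_set G S" "\<And>i. i \<in> I \<Longrightarrow> x i \<in> carrier G"
    "\<And>i. i \<in> I \<Longrightarrow> y i \<in> carrier G" "\<And>i. i \<in> I \<Longrightarrow> word_dist G S (x i) (y i) \<le> r"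
  shows "finite ((\<lambda>i. inv x i \<otimes> y i) ` I)"
  by (rule finite_subset[OF _ finite_word_ball[OF assms(1), of r]])
     (use assms(2-) in \<open>auto simp: word_dist_def\<close>)

end

text \<open>Only finitely many elements \<open>inv (f x) f (x a)\<close> occur for \<open>a\<close>
  a generator or its inverse. Their lengths are bounded, and the bound is summed along a shortest
  word from \<open>x\<close> to \<open>y\<close>.\<close>

lemma word_dist_lipschitz:
  fixes A :: "('a, 'k) monoid_scheme" and B :: "('b, 'l) monoid_scheme"
  assumes A: "group A" "finite_generating_set A SA" and B: "group B" "finite_generating_set B SB"
    and f: "f \<in> carrier A \<rightarrow> carrier B"
    and fin: "\<And>a. a \<in> carrier A \<Longrightarrow>
                finite ((\<lambda>x. inv\<^bsub>B\<^esub> f x \<otimes>\<^bsub>B\<^esub> f (x \<otimes>\<^bsub>A\<^esub> a)) ` carrier A)"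
  obtains K where "K \<ge> 1"
    "\<And>x y. x \<in> carrier A \<Longrightarrow> y \<in> carrier A \<Longrightarrow> word_dist B SB (f x) (f y) \<le> K * word_dist A SA x y"
proof -
  interpret A: group A by fact
  interpret B: group B by fact
  define L where "L = SA \<union> (\<lambda>s. inv\<^bsub>A\<^esub> s) ` SA"
  have L: "finite L" "L \<subseteq> carrier A" using A by (auto simp: L_def finite_generating_set_def)
  define U where "U = (\<Union>a\<in>L. (\<lambda>x. inv\<^bsub>B\<^esub> f x \<otimes>\<^bsub>B\<^esub> f (x \<otimes>\<^bsub>A\<^esub> a)) ` carrier A)"
  have "finite U" using L fin unfolding U_def by (intro finite_UN_I) auto
  then have "\<exists>M. \<forall>u\<in>U. real (word_length B SB u) \<le> M"
    by (intro exI[of _ "Max ((\<lambda>u. real (word_length B SB u)) ` U)"]) auto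
  then obtain M where M: "\<And>u. u \<in> U \<Longrightarrow> real (word_length B SB u) \<le> M" by blast
  \<comment> \<open>The maximum with 1 meets the condition \<open>K \<ge> 1\<close> in
    \<open>quasi_isometry\<close>.\<close>
  define K where "K = max 1 M"
  have word: "real (word_length B SB (inv\<^bsub>B\<^esub> f x \<otimes>\<^bsub>B\<^esub> f (x \<otimes>\<^bsub>A\<^esub> foldr (\<lambda>x y. x \<otimes>\<^bsub>A\<^esub> y) ws \<one>\<^bsub>A\<^esub>)))
          \<le> K * real (length ws)" if "set ws \<subseteq> L" "x \<in> carrier A" for ws x
    using that
  proof (induction ws arbitrary: x)
    case Nil
    with f show ?case by (simp add: Pi_iff B.word_length_one)
  next
    case (Cons a ws)
    let ?v = "foldr (\<lambda>x y. x \<otimes>\<^bsub>A\<^esub> y) ws \<one>\<^bsub>A\<^esub>"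
    have a: "a \<in> carrier A" "?v \<in> carrier A" using Cons.prems L A.foldr_mult_closed[of ws] by auto
    note fc = funcset_mem[OF f]
    have eq: "inv\<^bsub>B\<^esub> f x \<otimes>\<^bsub>B\<^esub> f (x \<otimes>\<^bsub>A\<^esub> (a \<otimes>\<^bsub>A\<^esub> ?v)) =
        (inv\<^bsub>B\<^esub> f x \<otimes>\<^bsub>B\<^esub> f (x \<otimes>\<^bsub>A\<^esub> a)) \<otimes>\<^bsub>B\<^esub>
          (inv\<^bsub>B\<^esub> f (x \<otimes>\<^bsub>A\<^esub> a) \<otimes>\<^bsub>B\<^esub> f (x \<otimes>\<^bsub>A\<^esub> a \<otimes>\<^bsub>A\<^esub> ?v))"
      using a Cons.prems(2) fc by (simp add: B.m_assoc A.m_assoc)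
    have "real (word_length B SB (inv\<^bsub>B\<^esub> f x \<otimes>\<^bsub>B\<^esub> f (x \<otimes>\<^bsub>A\<^esub> (a \<otimes>\<^bsub>A\<^esub> ?v))))
        \<le> real (word_length B SB (inv\<^bsub>B\<^esub> f x \<otimes>\<^bsub>B\<^esub> f (x \<otimes>\<^bsub>A\<^esub> a)))
          + real (word_length B SB (inv\<^bsub>B\<^esub> f (x \<otimes>\<^bsub>A\<^esub> a) \<otimes>\<^bsub>B\<^esub> f (x \<otimes>\<^bsub>A\<^esub> a \<otimes>\<^bsub>A\<^esub> ?v)))"
      unfolding eq of_nat_add[symmetric] of_nat_le_iff
      using a Cons.prems(2) fc by (intro B.word_length_mult_le B(2)) auto
    also have "real (word_length B SB (inv\<^bsub>B\<^esub> f x \<otimes>\<^bsub>B\<^esub> f (x \<otimes>\<^bsub>A\<^esub> a))) \<le> K"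
      using Cons.prems by (intro order_trans[OF M]) (auto simp: K_def U_def)
    also have "real (word_length B SB (inv\<^bsub>B\<^esub> f (x \<otimes>\<^bsub>A\<^esub> a) \<otimes>\<^bsub>B\<^esub> f (x \<otimes>\<^bsub>A\<^esub> a \<otimes>\<^bsub>A\<^esub> ?v)))
        \<le> K * real (length ws)"
      using Cons.prems a by (intro Cons.IH) auto
    finally show ?case by (simp add: algebra_simps)
  qed
  show ?thesis
  proof (rule that)
    show "K \<ge> 1" by (simp add: K_def)
    fix x y assume xy: "x \<in> carrier A" "y \<in> carrier A"
    then obtain ws where ws: "length ws = word_length A SA (inv\<^bsub>A\<^esub> x \<otimes>\<^bsub>A\<^esub> y)" "set ws \<subseteq> L"
      "foldr (\<lambda>x y. x \<otimes>\<^bsub>A\<^esub> y) ws \<one>\<^bsub>A\<^esub> = inv\<^bsub>A\<^esub> x \<otimes>\<^bsub>A\<^esub> y"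
      using A.word_length_witness[OF A(2), of "inv\<^bsub>A\<^esub> x \<otimes>\<^bsub>A\<^esub> y"] unfolding L_def by auto
    have "x \<otimes>\<^bsub>A\<^esub> (inv\<^bsub>A\<^esub> x \<otimes>\<^bsub>A\<^esub> y) = y" using xy by simp
    with word[OF ws(2) xy(1)] ws show "word_dist B SB (f x) (f y) \<le> K * word_dist A SA x y"
      by (simp add: word_dist_def)
  qed
qed

section \<open>Complements of central subgroups\<close>

text \<open>One more generator \<open>s\<close> with \<open>s [^] k = \<one>\<close> enlarges the
  generated subgroup by a factor of at most \<open>k\<close>, since exponents of \<open>s\<close>
  can be reduced modulo \<open>k\<close>.\<close>

lemma (in comm_group) finite_generate_torsion:
  assumes "finite S" "S \<subseteq> carrier G" "\<And>s. s \<in> S \<Longrightarrow> \<exists>k>0. s [^] (k::nat) = \<one>"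
  shows "finite (generate G S)"
  using assms
proof (induction S rule: finite_induct)
  case empty
  then show ?case by (simp add: generate_empty)
next
  case (insert s S)
  then obtain k :: nat where k: "k > 0" "s [^] k = \<one>" by auto
  have s: "s \<in> carrier G" and S: "S \<subseteq> carrier G" using insert.prems by auto
  note gc = generate_in_carrier[OF S]
  have pow: "s [^] n = s [^] (n mod k)" for n
  proof -
    have "s [^] n = s [^] (k * (n div k)) \<otimes> s [^] (n mod k)"
      using s by (simp add: nat_pow_mult)
    also have "s [^] (k * (n div k)) = \<one>" using s k by (simp flip: nat_pow_pow)
    finally show ?thesis using s by simp
  qed
  have decomp: "\<exists>n x. g = s [^] (n::nat) \<otimes> x \<and> x \<in> generate G S" if "g \<in> generate G (insert s S)" for g
    using that
  proof induction
    case one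
    show ?case by (rule exI[of _ 0], rule exI[of _ "\<one>"]) (simp add: generate.one)
  next
    case (incl h)
    show ?case
    proof (cases "h = s")
      case True
      then show ?thesis using s
        by (intro exI[of _ 1] exI[of _ "\<one>"]) (simp add: generate.one)
    next
      case False
      then have h: "h \<in> generate G S" using incl by (auto intro: generate.incl)
      then show ?thesis using gc by (intro exI[of _ 0] exI[of _ h]) simp
    qed
  next
    case (inv h)
    show ?case
    proof (cases "h = s")
      case True
      \<comment> \<open>This expresses \<open>inv s\<close> as a natural power, so no integer
        exponents are needed.\<close>
      have "s [^] (k - 1) \<otimes> s = \<one>" using k s
        by (metis Suc_diff_1 nat_pow_Suc)
      then have "inv s = s [^] (k - 1)" using s by (simp add: inv_equality)
      then show ?thesis using s True
        by (intro exI[of _ "k - 1"] exI[of _ "\<one>"]) (simp add: generate.one)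
    next
      case False
      then have h: "inv h \<in> generate G S" using inv by (auto intro: generate.inv)
      then show ?thesis using gc by (intro exI[of _ 0] exI[of _ "inv h"]) simp
    qed
  next
    case (eng g h)
    then obtain n x m y where g: "g = s [^] (n::nat) \<otimes> x" "x \<in> generate G S"
      and h: "h = s [^] (m::nat) \<otimes> y" "y \<in> generate G S" by blast
    have "g \<otimes> h = s [^] (n + m) \<otimes> (x \<otimes> y)"
      using g h gc s by (simp add: m_ac flip: nat_pow_mult)
    then show ?case using g h by (metis generate.eng)
  qed
  have "generate G (insert s S) \<subseteq> (\<lambda>(n, x). s [^] n \<otimes> x) ` ({..<k} \<times> generate G S)"
  proof
    fix g assume "g \<in> generate G (insert s S)"
    then obtain n x where "g = s [^] (n::nat) \<otimes> x" "x \<in> generate G S" using decomp by blast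
    then show "g \<in> (\<lambda>(n, x). s [^] n \<otimes> x) ` ({..<k} \<times> generate G S)"
      using pow[of n] k by (intro image_eqI[of _ _ "(n mod k, x)"]) auto
  qed
  moreover have "finite (generate G S)" using insert by auto
  ultimately show ?case by (auto intro: finite_subset)
qed

section \<open>Subgroups that contain the derived subgroup\<close>

context group
begin

lemma commutator_in_derived:
  "x \<in> carrier G \<Longrightarrow> y \<in> carrier G \<Longrightarrow> x \<otimes> y \<otimes> inv x \<otimes> inv y \<in> derived G (carrier G)"
  unfolding derived_def by (intro generate.incl) blast

text \<open>A conjugate of \<open>h\<close> by \<open>x\<close> is the commutator of
  \<open>x\<close> and \<open>h\<close>, times \<open>h\<close>.\<close>

lemma normal_if_derived_subset:
  assumes "subgroup H G" "derived G (carrier G) \<subseteq> H"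
  shows "H \<lhd> G"
proof (rule normal_invI[OF assms(1)])
  interpret H: subgroup H G by fact
  fix x h assume x: "x \<in> carrier G" and h: "h \<in> H"
  have "x \<otimes> h \<otimes> inv x \<otimes> inv h \<in> derived G (carrier G)"
    using x h by (simp add: commutator_in_derived)
  then have "x \<otimes> h \<otimes> inv x \<otimes> inv h \<otimes> h \<in> H" using assms(2) h by auto
  moreover have "x \<otimes> h \<otimes> inv x \<otimes> inv h \<otimes> h = x \<otimes> h \<otimes> inv x" using x h by (simp add: m_assoc)
  ultimately show "x \<otimes> h \<otimes> inv x \<in> H" by simp
qed

lemma comm_group_Mod_if_derived_subset:
  assumes H: "subgroup H G" "derived G (carrier G) \<subseteq> H"
  shows "comm_group (G Mod H)"
proof -
  interpret H: normal H G using normal_if_derived_subset[OF H] .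
  show ?thesis
  proof (rule group.group_comm_groupI[OF H.factorgroup_is_group])
    fix X Y assume "X \<in> carrier (G Mod H)" "Y \<in> carrier (G Mod H)"
    then obtain x y where x: "x \<in> carrier G" "X = H #> x" and y: "y \<in> carrier G" "Y = H #> y"
      by (auto simp: FactGroup_def RCOSETS_def)
    have "x \<otimes> y \<otimes> inv x \<otimes> inv y \<in> derived G (carrier G)"
      using x y by (simp add: commutator_in_derived)
    then have "x \<otimes> y \<otimes> inv x \<otimes> inv y \<otimes> (y \<otimes> x) \<in> H #> (y \<otimes> x)"
      using H(2) x y by (intro rcosI) auto
    moreover have "x \<otimes> y \<otimes> inv x \<otimes> inv y \<otimes> (y \<otimes> x) = x \<otimes> y" using x y by (simp add: m_assoc)
    ultimately have "H #> (y \<otimes> x) = H #> (x \<otimes> y)"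
      using x y H(1) by (intro repr_independence) auto
    then show "X \<otimes>\<^bsub>G Mod H\<^esub> Y = Y \<otimes>\<^bsub>G Mod H\<^esub> X" using x y by (simp add: FactGroup_def H.rcos_sum)
  qed
qed

text \<open>The quotient by \<open>H\<close> is an abelian group generated by finitely many torsion
  elements.\<close>

lemma finite_rcosets_if_torsion:
  assumes S: "finite_generating_set G S" and H: "subgroup H G" "derived G (carrier G) \<subseteq> H"
    and tor: "\<And>s. s \<in> S \<Longrightarrow> \<exists>k>0. s [^] (k::nat) \<in> H"
  shows "finite (rcosets H)"
proof -
  interpret H: normal H G using normal_if_derived_subset[OF H] .
  interpret Q: comm_group "G Mod H" using comm_group_Mod_if_derived_subset[OF H] .
  interpret q: group_hom G "G Mod H" "(#>) H"
    by unfold_locales (rule H.r_coset_hom_Mod)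
  have Sc: "S \<subseteq> carrier G" "finite S" "generate G S = carrier G"
    using S by (auto simp: finite_generating_set_def)
  have "finite (generate (G Mod H) ((#>) H ` S))"
  proof (rule Q.finite_generate_torsion)
    fix X assume "X \<in> (#>) H ` S"
    then obtain s where s: "s \<in> S" "X = H #> s" by auto
    then obtain k :: nat where k: "k > 0" "s [^] k \<in> H" using tor by blast
    have "X [^]\<^bsub>G Mod H\<^esub> k = H #> (s [^] k)" using s Sc by (auto simp: q.hom_nat_pow)
    also have "\<dots> = H" using k s Sc by (intro coset_join2[OF _ H(1)]) auto
    finally show "\<exists>k>0. X [^]\<^bsub>G Mod H\<^esub> (k::nat) = \<one>\<^bsub>G Mod H\<^esub>"
      using k by (auto simp: FactGroup_def)
  qed (use Sc in auto)
  also have "generate (G Mod H) ((#>) H ` S) = rcosets H"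
    using q.generate_img[OF Sc(1)] Sc(3) by (auto simp: RCOSETS_def)
  finally show ?thesis .
qed

text \<open>Among the subsets \<open>T\<close> of a finite generating set for which \<open>T\<close> and the derived subgroup
  generate a subgroup meeting \<open>B\<close> trivially, a maximal one gives the complement.\<close>

lemma virtual_complement:
  assumes S: "finite_generating_set G S" and B: "subgroup B G"
    and central: "\<And>b x. b \<in> B \<Longrightarrow> x \<in> carrier G \<Longrightarrow> b \<otimes> x = x \<otimes> b"
    and triv: "B \<inter> derived G (carrier G) \<subseteq> {\<one>}"
  obtains C where "subgroup C G" "B \<inter> C \<subseteq> {\<one>}" "(B <#> C) \<lhd> G" "finite (rcosets (B <#> C))"
proof -
  interpret B: subgroup B G by fact
  define D where "D = derived G (carrier G)"
  have D: "subgroup D G" "D \<subseteq> carrier G"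
    using derived_is_subgroup[of "carrier G"] subgroup.subset by (auto simp: D_def)
  have Sc: "S \<subseteq> carrier G" "finite S" using S by (auto simp: finite_generating_set_def)
  \<comment> \<open>Keeping \<open>D\<close> in every candidate makes the generated subgroups normal
    with abelian quotient, so the index of \<open>H\<close> below can be tested on powers of single
    generators.\<close>
  define M where "M = {T. T \<subseteq> S \<and> B \<inter> generate G (T \<union> D) \<subseteq> {\<one>}}"
  have "generate G D \<subseteq> D" using generate_subgroup_incl[OF _ D(1)] by simp
  then have "{} \<in> M" using triv by (auto simp: M_def D_def)
  moreover have "finite M" using Sc by (auto simp: M_def)
  ultimately obtain T where T: "T \<in> M" "\<And>T'. T' \<in> M \<Longrightarrow> T \<subseteq> T' \<Longrightarrow> T = T'"
    using finite_has_maximal[of M] by auto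
  have Tc: "T \<union> D \<subseteq> carrier G" "T \<subseteq> S" using T(1) Sc D by (auto simp: M_def)
  define C where "C = generate G (T \<union> D)"
  have C: "subgroup C G" using generate_is_subgroup[OF Tc(1)] by (simp add: C_def)
  have DC: "D \<subseteq> C" and TC: "T \<subseteq> C" by (auto simp: C_def intro: generate.incl)
  interpret C: normal C G using normal_if_derived_subset[OF C] DC by (simp add: D_def)
  have BC: "B \<inter> C \<subseteq> {\<one>}" using T(1) by (auto simp: M_def C_def)
  define H where "H = B <#> C"
  have mem: "h \<in> H \<longleftrightarrow> (\<exists>b\<in>B. \<exists>c\<in>C. h = b \<otimes> c)" for h by (auto simp: H_def set_mult_def)
  have memI: "b \<otimes> c \<in> H" if "b \<in> B" "c \<in> C" for b c using that mem by blast
  have H: "subgroup H G"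
  proof (rule subgroupI)
    show "H \<subseteq> carrier G" by (auto simp: mem)
    show "H \<noteq> {}" using memI[of "\<one>" "\<one>"] by auto
    fix g assume "g \<in> H"
    then obtain b c where g: "b \<in> B" "c \<in> C" "g = b \<otimes> c" using mem by auto
    then have "inv g = inv b \<otimes> inv c"
      using central[of "inv b" "inv c"] by (simp add: inv_mult_group)
    then show "inv g \<in> H" using g memI by simp
    fix h assume "h \<in> H"
    then obtain b' c' where h: "b' \<in> B" "c' \<in> C" "h = b' \<otimes> c'" using mem by auto
    have "g \<otimes> h = b \<otimes> (c \<otimes> b') \<otimes> c'" using g h by (simp add: m_assoc)
    also have "c \<otimes> b' = b' \<otimes> c" using g h central[of b' c] by simp
    finally have "g \<otimes> h = (b \<otimes> b') \<otimes> (c \<otimes> c')" using g h by (simp add: m_assoc)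
    then show "g \<otimes> h \<in> H" using g h memI by simp
  qed
  have CH: "C \<subseteq> H"
  proof
    fix c assume "c \<in> C"
    then show "c \<in> H" using memI[of "\<one>" c] by simp
  qed
  have tor: "\<exists>k>0. s [^] (k::nat) \<in> H" if s: "s \<in> S" for s
  proof (cases "s \<in> T")
    case True
    then have "s [^] (1::nat) \<in> H" using TC CH s Sc by (metis nat_pow_eone subsetD)
    then show ?thesis by blast
  next
    case False
    have sc: "s \<in> carrier G" using s Sc by auto
    \<comment> \<open>Normality of \<open>C\<close> allows all powers of \<open>s\<close> to be
      collected on the left.\<close>
    have gen: "\<exists>k c. g = s [^] (k::int) \<otimes> c \<and> c \<in> C" if "g \<in> generate G (insert s (T \<union> D))" for g
      using that
    proof induction
      case one
      show ?case by (rule exI[of _ 0], rule exI[of _ "\<one>"]) simp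
    next
      case (incl h)
      show ?case
      proof (cases "h = s")
        case True
        then show ?thesis using sc by (intro exI[of _ 1] exI[of _ "\<one>"]) simp
      next
        case False
        then have "h \<in> C" using incl by (auto simp: C_def intro: generate.incl)
        then show ?thesis by (intro exI[of _ 0] exI[of _ h]) simp
      qed
    next
      case (inv h)
      show ?case
      proof (cases "h = s")
        case True
        then show ?thesis using sc by (intro exI[of _ "- 1"] exI[of _ "\<one>"]) (simp add: int_pow_neg)
      next
        case False
        then have "inv h \<in> C" using inv by (auto simp: C_def intro: generate.inv)
        then show ?thesis by (intro exI[of _ 0] exI[of _ "inv h"]) simp
      qed
    next
      case (eng g h)
      then obtain k c l d where g: "g = s [^] (k::int) \<otimes> c" "c \<in> C"
        and h: "h = s [^] (l::int) \<otimes> d" "d \<in> C" by blast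
      have "inv (s [^] l) \<otimes> c \<otimes> s [^] l \<in> C" using g sc by (intro C.inv_op_closed1) auto
      then have "inv (s [^] l) \<otimes> c \<otimes> s [^] l \<otimes> d \<in> C" using h by auto
      moreover have "g \<otimes> h = s [^] (k + l) \<otimes> (inv (s [^] l) \<otimes> c \<otimes> s [^] l \<otimes> d)"
        using g h sc by (simp add: int_pow_mult m_assoc)
      ultimately show ?case by blast
    qed
    \<comment> \<open>By maximality, adding \<open>s\<close> creates a nontrivial \<open>b\<close>
      in \<open>B\<close>. Its exponent of \<open>s\<close> cannot be 0, for then \<open>b\<close>
      would lie in \<open>C\<close>; hence a nonzero power of \<open>s\<close> lies in
      \<open>B <#> C\<close>.\<close>
    have "insert s T \<notin> M" using T(2)[of "insert s T"] False by auto
    then obtain b where b: "b \<in> B" "b \<noteq> \<one>" "b \<in> generate G (insert s (T \<union> D))"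
      using s Tc(2) by (auto simp: M_def)
    then obtain k c where k: "b = s [^] (k::int) \<otimes> c" "c \<in> C" using gen by blast
    have "k \<noteq> 0" using k b BC by auto
    have "s [^] k = b \<otimes> inv c" using k sc by (simp add: m_assoc)
    then have "s [^] k \<in> H" using memI[OF b(1), of "inv c"] k by simp
    then have "s [^] (k * sgn k) \<in> H"
      using subgroup_int_pow_closed[OF H, of "s [^] k" "sgn k"] sc by (simp add: int_pow_pow)
    moreover have "k * sgn k = int (nat \<bar>k\<bar>)" by (auto simp: sgn_if)
    ultimately have "s [^] nat \<bar>k\<bar> \<in> H" by (metis int_pow_int)
    then show ?thesis using \<open>k \<noteq> 0\<close> by (intro exI[of _ "nat \<bar>k\<bar>"]) simp
  qed
  have DH: "derived G (carrier G) \<subseteq> H" using DC CH by (auto simp: D_def)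
  show ?thesis
    using that[OF C BC] normal_if_derived_subset[OF H DH] finite_rcosets_if_torsion[OF S H DH tor]
    by (simp add: H_def)
qed

end

text \<open>A power of every element lies in the sum of \<open>\<langle>z\<rangle>\<close> and a complement; project to \<open>\<langle>z\<rangle>\<close>.\<close>

lemma (in comm_group) additive_int_function_nonzero:
  assumes fg: "finite_generating_set G S" and tf: "torsion_free_group G"
    and z: "z \<in> carrier G" "z \<noteq> \<one>"
  obtains l :: "'a \<Rightarrow> int" where
    "\<And>x y. x \<in> carrier G \<Longrightarrow> y \<in> carrier G \<Longrightarrow> l (x \<otimes> y) = l x + l y" "l z \<noteq> 0"
proof -
  let ?B = "generate G {z}"
  have B: "?B = {z [^] (k::int) | k. True}" using generate_pow[OF z(1)] by simp
  obtain C where C: "subgroup C G" "?B \<inter> C \<subseteq> {\<one>}" "(?B <#> C) \<lhd> G" "finite (rcosets (?B <#> C))"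
  proof (rule virtual_complement[OF fg])
    show "subgroup ?B G" using z by (intro generate_is_subgroup) auto
    show "?B \<inter> derived G (carrier G) \<subseteq> {\<one>}" by (simp add: derived_eq_singleton)
  qed (use z generate_in_carrier[of "{z}"] in \<open>auto intro: m_comm\<close>)
  interpret C: subgroup C G by (rule C(1))
  interpret H: normal "?B <#> C" G by (rule C(3))
  interpret Q: group "G Mod (?B <#> C)" by (rule H.factorgroup_is_group)
  interpret q: group_hom G "G Mod (?B <#> C)" "(#>) (?B <#> C)"
    by unfold_locales (rule H.r_coset_hom_Mod)
  define N where "N = order (G Mod (?B <#> C))"
  have fin: "finite (carrier (G Mod (?B <#> C)))" using C(4) by (simp add: FactGroup_def)
  have N: "N > 0" using fin Q.order_gt_0_iff_finite by (simp add: N_def)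
  \<comment> \<open>The quotient by \<open>?B <#> C\<close> has order \<open>N\<close>, so all
    \<open>N\<close>-th powers land in this subgroup.\<close>
  have dec: "\<exists>k. \<exists>c\<in>C. x [^] N = z [^] (k::int) \<otimes> c" if x: "x \<in> carrier G" for x
  proof -
    have "(?B <#> C) #> (x [^] N) = ((?B <#> C) #> x) [^]\<^bsub>G Mod (?B <#> C)\<^esub> N"
      using x by (simp add: q.hom_nat_pow)
    also have "\<dots> = \<one>\<^bsub>G Mod (?B <#> C)\<^esub>"
      unfolding N_def using x fin by (intro Q.pow_order_eq_1) auto
    finally have "x [^] N \<in> ?B <#> C"
      using x H.subgroup_axioms coset_join1[of "?B <#> C" "x [^] N"] by (simp add: FactGroup_def)
    then show ?thesis by (auto simp: set_mult_def B)
  qed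
  have pow0: "k = 0" if "z [^] (k::int) \<in> C" for k
  proof -
    have "z [^] k = \<one>" using that C(2) B by blast
    then have "z [^] (k * sgn k) = \<one>" using z by (metis int_pow_one int_pow_pow)
    moreover have "k * sgn k = int (nat \<bar>k\<bar>)" by (auto simp: sgn_if)
    ultimately have "z [^] nat \<bar>k\<bar> = \<one>" by (metis int_pow_int)
    then show ?thesis using tf z unfolding torsion_free_group_def
      by (metis zero_less_abs_iff zero_less_nat_eq)
  qed
  have uniq: "k = l" if "z [^] (k::int) \<otimes> c = z [^] (l::int) \<otimes> d" "c \<in> C" "d \<in> C" for k l c d
  proof -
    have "z [^] (k - l) = z [^] k \<otimes> c \<otimes> inv c \<otimes> inv (z [^] l)"
      using that(2,3) z by (simp add: int_pow_diff m_assoc)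
    also have "\<dots> = d \<otimes> inv c" unfolding that(1) using that(2,3) z by (simp add: m_ac)
    finally show ?thesis using pow0[of "k - l"] that by auto
  qed
  \<comment> \<open>An element need not itself split along \<open>?B\<close> and \<open>C\<close>,
    but its \<open>N\<close>-th power does. Taking \<open>N\<close>-th powers is a homomorphism
    because the group is commutative; the price is the value \<open>l z = N\<close> instead of
    1.\<close>
  define l where "l x = (THE k. \<exists>c\<in>C. x [^] N = z [^] (k::int) \<otimes> c)" for x
  have l_eq: "l x = k" if "x [^] N = z [^] (k::int) \<otimes> c" "c \<in> C" for x k c
    unfolding l_def
  proof (rule the_equality)
    show "\<exists>c\<in>C. x [^] N = z [^] k \<otimes> c" using that by blast
  next
    fix k' assume "\<exists>c\<in>C. x [^] N = z [^] (k'::int) \<otimes> c"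
    then show "k' = k" using that uniq by metis
  qed
  show ?thesis
  proof (rule that)
    fix x y assume xy: "x \<in> carrier G" "y \<in> carrier G"
    obtain k c where k: "c \<in> C" "x [^] N = z [^] (k::int) \<otimes> c" using dec xy by blast
    obtain m d where m: "d \<in> C" "y [^] N = z [^] (m::int) \<otimes> d" using dec xy by blast
    have "(x \<otimes> y) [^] N = (z [^] k \<otimes> c) \<otimes> (z [^] m \<otimes> d)"
      using xy k m by (simp add: pow_mult_distrib m_comm)
    also have "\<dots> = z [^] (k + m) \<otimes> (c \<otimes> d)" using k m z by (simp add: int_pow_mult m_ac)
    finally show "l (x \<otimes> y) = l x + l y" using k m l_eq by (metis C.m_closed)
  next
    have "z [^] N = z [^] (int N) \<otimes> \<one>" using z by (simp add: int_pow_int)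
    then show "l z \<noteq> 0" using l_eq[of z "int N" "\<one>"] N by simp
  qed
qed

section \<open>Coarse sections of central extensions\<close>

locale central_ext =
  fixes Z :: "('z, 'k) monoid_scheme" and E :: "('e, 'l) monoid_scheme"
    and G :: "('g, 'm) monoid_scheme" and \<iota> :: "'z \<Rightarrow> 'e" and \<pi> :: "'e \<Rightarrow> 'g"
  assumes ext: "central_extension Z E G \<iota> \<pi>" and comm: "comm_group Z"
begin

sublocale Z: comm_group Z by (rule comm)

sublocale E: group E using ext by (simp add: central_extension_def)

sublocale G: group G using ext by (simp add: central_extension_def)

sublocale i: group_hom Z E \<iota>
  using ext by unfold_locales (simp add: central_extension_def)

sublocale p: group_hom E G \<pi>
  using ext by unfold_locales (simp add: central_extension_def)

lemma central: "z \<in> carrier Z \<Longrightarrow> h \<in> carrier E \<Longrightarrow> \<iota> z \<otimes>\<^bsub>E\<^esub> h = h \<otimes>\<^bsub>E\<^esub> \<iota> z"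
  using ext by (simp add: central_extension_def)

lemma pi_iota [simp]: "z \<in> carrier Z \<Longrightarrow> \<pi> (\<iota> z) = \<one>\<^bsub>G\<^esub>"
  using ext by (auto simp: central_extension_def kernel_def)

definition zpart :: "'e \<Rightarrow> 'z" where
  "zpart = inv_into (carrier Z) \<iota>"

lemma zpart_iota [simp]: "z \<in> carrier Z \<Longrightarrow> zpart (\<iota> z) = z"
  using ext by (simp add: zpart_def central_extension_def)

lemma zpart_kernel:
  assumes "h \<in> carrier E" "\<pi> h = \<one>\<^bsub>G\<^esub>"
  shows "zpart h \<in> carrier Z" "\<iota> (zpart h) = h"
proof -
  have "h \<in> \<iota> ` carrier Z" using assms ext by (simp add: central_extension_def kernel_def)
  then show "zpart h \<in> carrier Z" "\<iota> (zpart h) = h"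
    by (auto simp: zpart_def inv_into_into f_inv_into_f)
qed

definition lift :: "'g \<Rightarrow> 'e" where
  "lift = inv_into (carrier E) \<pi>"

lemma lift [simp]:
  assumes "g \<in> carrier G"
  shows "lift g \<in> carrier E" "\<pi> (lift g) = g"
proof -
  have "g \<in> \<pi> ` carrier E" using assms ext by (simp add: central_extension_def)
  then show "lift g \<in> carrier E" "\<pi> (lift g) = g"
    by (auto simp: lift_def inv_into_into f_inv_into_f)
qed

end

text \<open>This is a Lipschitz section stated without generating sets: in a left-invariant word
  metric \<open>g\<close> and \<open>g t\<close> are as far apart as \<open>1\<close> and
  \<open>t\<close>, and balls are finite.\<close>

locale coarse_section = central_ext Z E G \<iota> \<pi>
  for Z :: "('z, 'k) monoid_scheme" and E :: "('e, 'l) monoid_scheme"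
    and G :: "('g, 'm) monoid_scheme" and \<iota> :: "'z \<Rightarrow> 'e" and \<pi> :: "'e \<Rightarrow> 'g" +
  fixes s :: "'g \<Rightarrow> 'e"
  assumes section_closed [simp]: "g \<in> carrier G \<Longrightarrow> s g \<in> carrier E"
    and pi_section [simp]: "g \<in> carrier G \<Longrightarrow> \<pi> (s g) = g"
    and finite_section_increments:
      "t \<in> carrier G \<Longrightarrow> finite ((\<lambda>g. inv\<^bsub>E\<^esub> s g \<otimes>\<^bsub>E\<^esub> s (g \<otimes>\<^bsub>G\<^esub> t)) ` carrier G)"
begin

text \<open>Paired with \<open>\<pi>\<close> it is a bijection from \<open>E\<close> to
  \<open>Z \<times>\<times> G\<close> with inverse
  \<open>(z, g) \<mapsto> s g \<iota> z\<close>.\<close>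

definition fibre_coord :: "'e \<Rightarrow> 'z" where
  "fibre_coord h = zpart (inv\<^bsub>E\<^esub> s (\<pi> h) \<otimes>\<^bsub>E\<^esub> h)"

lemma fibre_coord:
  assumes "h \<in> carrier E"
  shows fibre_coord_closed [simp]: "fibre_coord h \<in> carrier Z"
    and section_fibre_coord: "s (\<pi> h) \<otimes>\<^bsub>E\<^esub> \<iota> (fibre_coord h) = h"
  using assms zpart_kernel[of "inv\<^bsub>E\<^esub> s (\<pi> h) \<otimes>\<^bsub>E\<^esub> h"] by (auto simp: fibre_coord_def)

lemma fibre_coord_section:
  assumes "g \<in> carrier G" "z \<in> carrier Z"
  shows "fibre_coord (s g \<otimes>\<^bsub>E\<^esub> \<iota> z) = z"
  using assms by (simp add: fibre_coord_def)

lemma fibre_coord_mult_iota: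
  assumes "h \<in> carrier E" "z \<in> carrier Z"
  shows "fibre_coord (h \<otimes>\<^bsub>E\<^esub> \<iota> z) = fibre_coord h \<otimes>\<^bsub>Z\<^esub> z"
proof -
  have "h \<otimes>\<^bsub>E\<^esub> \<iota> z = s (\<pi> h) \<otimes>\<^bsub>E\<^esub> \<iota> (fibre_coord h \<otimes>\<^bsub>Z\<^esub> z)"
    using assms section_fibre_coord[of h] by (simp flip: E.m_assoc)
  then show ?thesis using assms by (simp add: fibre_coord_section del: i.hom_mult)
qed

text \<open>Since \<open>\<iota>\<close> is central, the coordinate of \<open>h\<close> moves past
  \<open>a\<close>, and what remains is the comparison of \<open>a\<close> with the increment of the
  section. So \<open>h\<close> enters only through \<open>\<pi> h\<close>, and only through one of
  finitely many section increments.\<close>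

lemma fibre_coord_increment:
  assumes h: "h \<in> carrier E" and a: "a \<in> carrier E"
  shows "inv\<^bsub>Z\<^esub> fibre_coord h \<otimes>\<^bsub>Z\<^esub> fibre_coord (h \<otimes>\<^bsub>E\<^esub> a) =
    zpart (inv\<^bsub>E\<^esub> (inv\<^bsub>E\<^esub> s (\<pi> h) \<otimes>\<^bsub>E\<^esub> s (\<pi> h \<otimes>\<^bsub>G\<^esub> \<pi> a)) \<otimes>\<^bsub>E\<^esub> a)"
proof -
  define u where "u = inv\<^bsub>E\<^esub> s (\<pi> h) \<otimes>\<^bsub>E\<^esub> s (\<pi> h \<otimes>\<^bsub>G\<^esub> \<pi> a)"
  define z where "z = fibre_coord h"
  define w where "w = zpart (inv\<^bsub>E\<^esub> u \<otimes>\<^bsub>E\<^esub> a)"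
  have u: "u \<in> carrier E" "\<pi> u = \<pi> a" "s (\<pi> h \<otimes>\<^bsub>G\<^esub> \<pi> a) = s (\<pi> h) \<otimes>\<^bsub>E\<^esub> u"
    using h a by (simp_all add: u_def)
  have z: "z \<in> carrier Z" using h by (simp add: z_def)
  have w: "w \<in> carrier Z" "\<iota> w = inv\<^bsub>E\<^esub> u \<otimes>\<^bsub>E\<^esub> a"
    using zpart_kernel[of "inv\<^bsub>E\<^esub> u \<otimes>\<^bsub>E\<^esub> a"] u a by (auto simp: w_def)
  have "h \<otimes>\<^bsub>E\<^esub> a = s (\<pi> h) \<otimes>\<^bsub>E\<^esub> (\<iota> z \<otimes>\<^bsub>E\<^esub> a)"
    using section_fibre_coord[OF h] h a z by (simp add: z_def flip: E.m_assoc)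
  also have "\<iota> z \<otimes>\<^bsub>E\<^esub> a = u \<otimes>\<^bsub>E\<^esub> \<iota> (w \<otimes>\<^bsub>Z\<^esub> z)"
    using z a u w central by (simp add: E.m_assoc[symmetric])
  also have "s (\<pi> h) \<otimes>\<^bsub>E\<^esub> (u \<otimes>\<^bsub>E\<^esub> \<iota> (w \<otimes>\<^bsub>Z\<^esub> z)) = s (\<pi> h \<otimes>\<^bsub>G\<^esub> \<pi> a) \<otimes>\<^bsub>E\<^esub> \<iota> (w \<otimes>\<^bsub>Z\<^esub> z)"
    unfolding u(3) using u z w h by (simp add: E.m_assoc del: i.hom_mult)
  finally have "fibre_coord (h \<otimes>\<^bsub>E\<^esub> a) = w \<otimes>\<^bsub>Z\<^esub> z"
    using h a w z by (simp add: fibre_coord_section del: i.hom_mult)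
  also have "w \<otimes>\<^bsub>Z\<^esub> z = z \<otimes>\<^bsub>Z\<^esub> w" using w z by (simp add: Z.m_comm)
  finally show ?thesis using w z by (simp flip: z_def u_def w_def)
qed

lemma finite_fibre_coord_increments:
  assumes "a \<in> carrier E"
  shows "finite ((\<lambda>h. inv\<^bsub>Z\<^esub> fibre_coord h \<otimes>\<^bsub>Z\<^esub> fibre_coord (h \<otimes>\<^bsub>E\<^esub> a)) ` carrier E)"
proof (rule finite_subset)
  let ?U = "(\<lambda>g. inv\<^bsub>E\<^esub> s g \<otimes>\<^bsub>E\<^esub> s (g \<otimes>\<^bsub>G\<^esub> \<pi> a)) ` carrier G"
  show "finite ((\<lambda>u. zpart (inv\<^bsub>E\<^esub> u \<otimes>\<^bsub>E\<^esub> a)) ` ?U)"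
    using assms by (intro finite_imageI finite_section_increments) simp
  show "(\<lambda>h. inv\<^bsub>Z\<^esub> fibre_coord h \<otimes>\<^bsub>Z\<^esub> fibre_coord (h \<otimes>\<^bsub>E\<^esub> a)) ` carrier E \<subseteq> \<dots>"
    using assms by (auto simp: fibre_coord_increment)
qed

text \<open>The bijection \<open>h \<mapsto> (fibre_coord h, \<pi> h)\<close> and its inverse both
  have finitely many increments, so they are Lipschitz. The additive constant is 0 and the
  projections to \<open>G\<close> agree exactly.\<close>

lemma quasi_isometrically_trivial:
  assumes SE: "finite_generating_set E SE" and SZG: "finite_generating_set (Z \<times>\<times> G) SZG"
  shows "quasi_isometrically_trivial Z E G \<pi> SE SZG SG"
proof -
  interpret ZG: group "Z \<times>\<times> G" by (intro DirProd_group Z.is_group G.is_group)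
  define f where "f h = (fibre_coord h, \<pi> h)" for h
  define k where "k = (\<lambda>(z, g). s g \<otimes>\<^bsub>E\<^esub> \<iota> z)"
  have f: "f \<in> carrier E \<rightarrow> carrier (Z \<times>\<times> G)" by (auto simp: f_def)
  have k: "k \<in> carrier (Z \<times>\<times> G) \<rightarrow> carrier E" by (auto simp: k_def)
  have kf: "k (f h) = h" if "h \<in> carrier E" for h
    using that by (simp add: f_def k_def section_fibre_coord)
  have fk: "f (k y) = y" if "y \<in> carrier (Z \<times>\<times> G)" for y
    using that by (auto simp: f_def k_def fibre_coord_section)
  obtain K1 where K1: "K1 \<ge> 1" "\<And>x y. x \<in> carrier E \<Longrightarrow> y \<in> carrier E \<Longrightarrow>
      word_dist (Z \<times>\<times> G) SZG (f x) (f y) \<le> K1 * word_dist E SE x y"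
  proof (rule word_dist_lipschitz[OF E.is_group SE ZG.is_group SZG f])
    fix a assume a: "a \<in> carrier E"
    let ?U = "(\<lambda>h. inv\<^bsub>Z\<^esub> fibre_coord h \<otimes>\<^bsub>Z\<^esub> fibre_coord (h \<otimes>\<^bsub>E\<^esub> a)) ` carrier E"
    have "(\<lambda>h. inv\<^bsub>Z \<times>\<times> G\<^esub> f h \<otimes>\<^bsub>Z \<times>\<times> G\<^esub> f (h \<otimes>\<^bsub>E\<^esub> a)) ` carrier E \<subseteq> ?U \<times> {\<pi> a}"
      using a by (auto simp: f_def inv_DirProd[OF Z.is_group G.is_group])
    then show "finite ((\<lambda>h. inv\<^bsub>Z \<times>\<times> G\<^esub> f h \<otimes>\<^bsub>Z \<times>\<times> G\<^esub> f (h \<otimes>\<^bsub>E\<^esub> a)) ` carrier E)"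
      using finite_fibre_coord_increments[OF a] by (auto intro: finite_subset)
  qed blast
  obtain K2 where K2: "K2 \<ge> 1" "\<And>x y. x \<in> carrier (Z \<times>\<times> G) \<Longrightarrow> y \<in> carrier (Z \<times>\<times> G) \<Longrightarrow>
      word_dist E SE (k x) (k y) \<le> K2 * word_dist (Z \<times>\<times> G) SZG x y"
  proof (rule word_dist_lipschitz[OF ZG.is_group SZG E.is_group SE k])
    fix a assume "a \<in> carrier (Z \<times>\<times> G)"
    then obtain z t where a: "a = (z, t)" "z \<in> carrier Z" "t \<in> carrier G" by auto
    let ?U = "(\<lambda>g. inv\<^bsub>E\<^esub> s g \<otimes>\<^bsub>E\<^esub> s (g \<otimes>\<^bsub>G\<^esub> t)) ` carrier G"
    \<comment> \<open>The central factor \<open>\<iota> w\<close> cancels, which removes the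
      dependence on the possibly infinite group \<open>Z\<close>.\<close>
    have "inv\<^bsub>E\<^esub> k (w, g) \<otimes>\<^bsub>E\<^esub> k ((w, g) \<otimes>\<^bsub>Z \<times>\<times> G\<^esub> a) =
        inv\<^bsub>E\<^esub> s g \<otimes>\<^bsub>E\<^esub> s (g \<otimes>\<^bsub>G\<^esub> t) \<otimes>\<^bsub>E\<^esub> \<iota> z"
      if "w \<in> carrier Z" "g \<in> carrier G" for w g
    proof -
      have "k ((w, g) \<otimes>\<^bsub>Z \<times>\<times> G\<^esub> a) = \<iota> w \<otimes>\<^bsub>E\<^esub> (s (g \<otimes>\<^bsub>G\<^esub> t) \<otimes>\<^bsub>E\<^esub> \<iota> z)"
        using that a central[of w "s (g \<otimes>\<^bsub>G\<^esub> t)"] by (simp add: k_def flip: E.m_assoc)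
      moreover have "inv\<^bsub>E\<^esub> k (w, g) = inv\<^bsub>E\<^esub> s g \<otimes>\<^bsub>E\<^esub> inv\<^bsub>E\<^esub> \<iota> w"
        using that central[of w "s g"] by (simp add: k_def flip: E.inv_mult_group)
      ultimately show ?thesis using that a by (simp add: E.m_assoc)
    qed
    then have "(\<lambda>x. inv\<^bsub>E\<^esub> k x \<otimes>\<^bsub>E\<^esub> k (x \<otimes>\<^bsub>Z \<times>\<times> G\<^esub> a)) ` carrier (Z \<times>\<times> G)
        \<subseteq> (\<lambda>u. u \<otimes>\<^bsub>E\<^esub> \<iota> z) ` ?U" by fastforce
    then show "finite ((\<lambda>x. inv\<^bsub>E\<^esub> k x \<otimes>\<^bsub>E\<^esub> k (x \<otimes>\<^bsub>Z \<times>\<times> G\<^esub> a)) ` carrier (Z \<times>\<times> G))"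
      by (rule finite_subset[OF _ finite_imageI[OF finite_section_increments[OF a(3)]]])
  qed blast
  define K where "K = max K1 K2"
  have nonneg: "0 \<le> word_dist H S x y" for H :: "('x, 'y) monoid_scheme" and S x y
    by (simp add: word_dist_def)
  have K: "K \<ge> 1" using K1 by (simp add: K_def)
  have upper: "word_dist (Z \<times>\<times> G) SZG (f x) (f y) \<le> K * word_dist E SE x y + 0"
    if "x \<in> carrier E" "y \<in> carrier E" for x y
  proof -
    have "word_dist (Z \<times>\<times> G) SZG (f x) (f y) \<le> K1 * word_dist E SE x y" using K1 that by auto
    also have "\<dots> \<le> K * word_dist E SE x y" by (intro mult_right_mono nonneg) (simp add: K_def)
    finally show ?thesis by simp
  qed
  have lower: "word_dist E SE x y / K - 0 \<le> word_dist (Z \<times>\<times> G) SZG (f x) (f y)"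
    if "x \<in> carrier E" "y \<in> carrier E" for x y
  proof -
    have "word_dist E SE (k (f x)) (k (f y)) \<le> K2 * word_dist (Z \<times>\<times> G) SZG (f x) (f y)"
      using K2 that f by blast
    also have "\<dots> \<le> K * word_dist (Z \<times>\<times> G) SZG (f x) (f y)"
      by (intro mult_right_mono nonneg) (simp add: K_def)
    finally show ?thesis using K that by (simp add: kf field_simps)
  qed
  have dense: "\<exists>x\<in>carrier E. word_dist (Z \<times>\<times> G) SZG (f x) y \<le> 0" if "y \<in> carrier (Z \<times>\<times> G)" for y
  proof (rule bexI)
    show "word_dist (Z \<times>\<times> G) SZG (f (k y)) y \<le> 0"
      unfolding fk[OF that] word_dist_def using that by (simp only: ZG.l_inv ZG.word_length_one)
  qed (use k that in blast)
  have "quasi_isometry (carrier E) (word_dist E SE) (carrier (Z \<times>\<times> G)) (word_dist (Z \<times>\<times> G) SZG) f"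
    unfolding quasi_isometry_def
    using f K upper lower dense by (intro conjI exI[of _ K] exI[of _ "0::real"] ballI) auto
  moreover have "bdd_above ((\<lambda>h. word_dist G SG (\<pi> h) (snd (f h))) ` carrier E)"
    by (rule bdd_aboveI[of _ 0]) (auto simp: f_def word_dist_def G.word_length_one)
  ultimately show ?thesis by (auto simp: quasi_isometrically_trivial_def)
qed

end

section \<open>From quasi-isometric triviality to a coarse section\<close>

context central_ext
begin

lemma coarse_sectionI:
  assumes "\<And>g. g \<in> carrier G \<Longrightarrow> s g \<in> carrier E" "\<And>g. g \<in> carrier G \<Longrightarrow> \<pi> (s g) = g"
    "\<And>t. t \<in> carrier G \<Longrightarrow> finite ((\<lambda>g. inv\<^bsub>E\<^esub> s g \<otimes>\<^bsub>E\<^esub> s (g \<otimes>\<^bsub>G\<^esub> t)) ` carrier G)"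
  shows "coarse_section Z E G \<iota> \<pi> s"
  using assms by unfold_locales

text \<open>The section picks an element \<open>x g\<close> that the quasi-isometry sends close to \<open>(1, g)\<close> and
  corrects it by one of finitely many elements of \<open>E\<close> so that it lies over \<open>g\<close>.\<close>

lemma coarse_section_if_quasi_isometrically_trivial:
  assumes SE: "finite_generating_set E SE" and SZG: "finite_generating_set (Z \<times>\<times> G) SZG"
    and SG: "finite_generating_set G SG"
    and qit: "quasi_isometrically_trivial Z E G \<pi> SE SZG SG"
  obtains s where "coarse_section Z E G \<iota> \<pi> s"
proof -
  interpret ZG: group "Z \<times>\<times> G" by (intro DirProd_group Z.is_group G.is_group)
  obtain f where qi: "quasi_isometry (carrier E) (word_dist E SE) (carrier (Z \<times>\<times> G))
        (word_dist (Z \<times>\<times> G) SZG) f"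
    and bdd: "bdd_above ((\<lambda>h. word_dist G SG (\<pi> h) (snd (f h))) ` carrier E)"
    using qit by (auto simp: quasi_isometrically_trivial_def)
  have f: "f h \<in> carrier (Z \<times>\<times> G)" if "h \<in> carrier E" for h
    using qi that by (auto simp: quasi_isometry_def)
  then have snd_f: "snd (f h) \<in> carrier G" if "h \<in> carrier E" for h
    using that by (metis DirProd_def mem_Times_iff partial_object.select_convs(1))
  obtain K C where K: "K \<ge> 1"
    and lower: "\<And>x y. x \<in> carrier E \<Longrightarrow> y \<in> carrier E \<Longrightarrow>
        word_dist E SE x y / K - C \<le> word_dist (Z \<times>\<times> G) SZG (f x) (f y)"
    and dense: "\<And>y. y \<in> carrier (Z \<times>\<times> G) \<Longrightarrow>
        \<exists>x\<in>carrier E. word_dist (Z \<times>\<times> G) SZG (f x) y \<le> C"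
    using qi unfolding quasi_isometry_def by blast
  obtain D where D: "\<And>h. h \<in> carrier E \<Longrightarrow> word_dist G SG (\<pi> h) (snd (f h)) \<le> D"
    using bdd by (auto simp: bdd_above_def)
  have "\<forall>g\<in>carrier G. \<exists>x\<in>carrier E. word_dist (Z \<times>\<times> G) SZG (f x) (\<one>\<^bsub>Z\<^esub>, g) \<le> C"
    using dense by simp
  then obtain x where x: "\<And>g. g \<in> carrier G \<Longrightarrow> x g \<in> carrier E"
    and xC: "\<And>g. g \<in> carrier G \<Longrightarrow> word_dist (Z \<times>\<times> G) SZG (f (x g)) (\<one>\<^bsub>Z\<^esub>, g) \<le> C"
    by metis
  define P where "P g = inv\<^bsub>Z \<times>\<times> G\<^esub> f (x g) \<otimes>\<^bsub>Z \<times>\<times> G\<^esub> (\<one>\<^bsub>Z\<^esub>, g)" for g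
  define Q where "Q g = inv\<^bsub>G\<^esub> \<pi> (x g) \<otimes>\<^bsub>G\<^esub> snd (f (x g))" for g
  have finP: "finite (P ` carrier G)"
    unfolding P_def using x f xC by (intro ZG.finite_word_dist_ball[OF SZG, of _ _ _ C]) auto
  have finQ: "finite (Q ` carrier G)"
    unfolding Q_def using x snd_f D by (intro G.finite_word_dist_ball[OF SG, of _ _ _ D]) auto
  have P: "P g \<in> carrier (Z \<times>\<times> G)" if "g \<in> carrier G" for g
    using that x f unfolding P_def by (intro ZG.m_closed ZG.inv_closed) auto
  \<comment> \<open>The error \<open>v g\<close> of \<open>x g\<close> over \<open>G\<close> is the
    product of two bounded errors: \<open>Q g\<close> compares \<open>\<pi>\<close> with the second
    component of \<open>f\<close>, and \<open>P g\<close> compares \<open>f (x g)\<close> with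
    \<open>(1, g)\<close>.\<close>
  define v where "v g = inv\<^bsub>G\<^esub> \<pi> (x g) \<otimes>\<^bsub>G\<^esub> g" for g
  have v: "v g \<in> carrier G" if "g \<in> carrier G" for g using that x by (simp add: v_def)
  have "v g = Q g \<otimes>\<^bsub>G\<^esub> snd (P g)" if g: "g \<in> carrier G" for g
  proof -
    obtain z h where zh: "f (x g) = (z, h)" "z \<in> carrier Z" "h \<in> carrier G"
      using f[OF x[OF g]] by auto
    then show ?thesis
      using x g by (simp add: v_def Q_def P_def inv_DirProd[OF Z.is_group G.is_group] G.m_assoc)
  qed
  then have "v ` carrier G \<subseteq> (\<lambda>(q, p). q \<otimes>\<^bsub>G\<^esub> snd p) ` (Q ` carrier G \<times> P ` carrier G)"
    by force
  then have finv: "finite (v ` carrier G)"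
    by (rule finite_subset[OF _ finite_imageI[OF finite_cartesian_product[OF finQ finP]]])
  define s where "s g = x g \<otimes>\<^bsub>E\<^esub> lift (v g)" for g
  have "coarse_section Z E G \<iota> \<pi> s"
  proof (rule coarse_sectionI)
    fix g assume g: "g \<in> carrier G"
    show "s g \<in> carrier E" "\<pi> (s g) = g" using g x v[OF g] by (simp_all add: s_def) (simp add: v_def)
  next
    fix t assume t: "t \<in> carrier G"
    let ?y = "\<lambda>g. inv\<^bsub>Z \<times>\<times> G\<^esub> f (x g) \<otimes>\<^bsub>Z \<times>\<times> G\<^esub> f (x (g \<otimes>\<^bsub>G\<^esub> t))"
    \<comment> \<open>The images of \<open>x g\<close> and \<open>x (g t)\<close> are near
      \<open>(1, g)\<close> and \<open>(1, g t)\<close>, whose quotient is the constant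
      \<open>(1, t)\<close>. The quotient of the images therefore takes finitely many values, and
      the lower quasi-isometry inequality brings this back to \<open>E\<close>.\<close>
    have "?y g = P g \<otimes>\<^bsub>Z \<times>\<times> G\<^esub> (\<one>\<^bsub>Z\<^esub>, t) \<otimes>\<^bsub>Z \<times>\<times> G\<^esub> inv\<^bsub>Z \<times>\<times> G\<^esub> P (g \<otimes>\<^bsub>G\<^esub> t)"
      if g: "g \<in> carrier G" for g
    proof -
      have c: "f (x g) \<in> carrier (Z \<times>\<times> G)" "f (x (g \<otimes>\<^bsub>G\<^esub> t)) \<in> carrier (Z \<times>\<times> G)"
        "(\<one>\<^bsub>Z\<^esub>, g) \<in> carrier (Z \<times>\<times> G)" "(\<one>\<^bsub>Z\<^esub>, t) \<in> carrier (Z \<times>\<times> G)"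
        "(\<one>\<^bsub>Z\<^esub>, g \<otimes>\<^bsub>G\<^esub> t) \<in> carrier (Z \<times>\<times> G)"
        using g t x f by auto
      have eq: "(\<one>\<^bsub>Z\<^esub>, g \<otimes>\<^bsub>G\<^esub> t) = (\<one>\<^bsub>Z\<^esub>, g) \<otimes>\<^bsub>Z \<times>\<times> G\<^esub> (\<one>\<^bsub>Z\<^esub>, t)" by simp
      have "P g \<otimes>\<^bsub>Z \<times>\<times> G\<^esub> (\<one>\<^bsub>Z\<^esub>, t) =
          inv\<^bsub>Z \<times>\<times> G\<^esub> f (x g) \<otimes>\<^bsub>Z \<times>\<times> G\<^esub> (\<one>\<^bsub>Z\<^esub>, g \<otimes>\<^bsub>G\<^esub> t)"
        unfolding P_def eq by (rule ZG.m_assoc[OF ZG.inv_closed[OF c(1)] c(3,4)])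
      also have "\<dots> \<otimes>\<^bsub>Z \<times>\<times> G\<^esub> inv\<^bsub>Z \<times>\<times> G\<^esub> P (g \<otimes>\<^bsub>G\<^esub> t) = ?y g"
        unfolding P_def by (rule ZG.inv_mult_mult_inv[OF c(1,2,5)])
      finally show ?thesis by simp
    qed
    then have "?y ` carrier G \<subseteq> (\<lambda>(p, q). p \<otimes>\<^bsub>Z \<times>\<times> G\<^esub> (\<one>\<^bsub>Z\<^esub>, t) \<otimes>\<^bsub>Z \<times>\<times> G\<^esub> inv\<^bsub>Z \<times>\<times> G\<^esub> q) `
        (P ` carrier G \<times> P ` carrier G)"
      using t by (force simp: image_iff)
    then have "finite (?y ` carrier G)"
      by (rule finite_subset[OF _ finite_imageI[OF finite_cartesian_product[OF finP finP]]])
    then have "bdd_above ((\<lambda>y. real (word_length (Z \<times>\<times> G) SZG y)) ` ?y ` carrier G)"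
      by (rule bdd_above_finite[OF finite_imageI])
    then obtain M where "\<And>g. g \<in> carrier G \<Longrightarrow> real (word_length (Z \<times>\<times> G) SZG (?y g)) \<le> M"
      by (force simp: bdd_above_def)
    then have M: "word_dist (Z \<times>\<times> G) SZG (f (x g)) (f (x (g \<otimes>\<^bsub>G\<^esub> t))) \<le> M" if "g \<in> carrier G" for g
      using that by (simp add: word_dist_def)
    have "word_dist E SE (x g) (x (g \<otimes>\<^bsub>G\<^esub> t)) \<le> K * (M + C)" if "g \<in> carrier G" for g
    proof -
      have "word_dist E SE (x g) (x (g \<otimes>\<^bsub>G\<^esub> t)) / K \<le> M + C"
        using lower[of "x g" "x (g \<otimes>\<^bsub>G\<^esub> t)"] M[OF that] that t x by simp
      then show ?thesis using K by (simp add: field_simps)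
    qed
    then have fin: "finite ((\<lambda>g. inv\<^bsub>E\<^esub> x g \<otimes>\<^bsub>E\<^esub> x (g \<otimes>\<^bsub>G\<^esub> t)) ` carrier G)" (is "finite ?R")
      using x t by (intro E.finite_word_dist_ball[OF SE, of _ _ _ "K * (M + C)"]) auto
    have "inv\<^bsub>E\<^esub> s g \<otimes>\<^bsub>E\<^esub> s (g \<otimes>\<^bsub>G\<^esub> t) =
        inv\<^bsub>E\<^esub> lift (v g) \<otimes>\<^bsub>E\<^esub> (inv\<^bsub>E\<^esub> x g \<otimes>\<^bsub>E\<^esub> x (g \<otimes>\<^bsub>G\<^esub> t)) \<otimes>\<^bsub>E\<^esub> lift (v (g \<otimes>\<^bsub>G\<^esub> t))"
      if "g \<in> carrier G" for g
      using that t x v by (simp add: s_def E.inv_mult_group E.m_assoc)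
    then have "(\<lambda>g. inv\<^bsub>E\<^esub> s g \<otimes>\<^bsub>E\<^esub> s (g \<otimes>\<^bsub>G\<^esub> t)) ` carrier G \<subseteq>
        (\<lambda>(p, r, q). inv\<^bsub>E\<^esub> lift p \<otimes>\<^bsub>E\<^esub> r \<otimes>\<^bsub>E\<^esub> lift q) ` (v ` carrier G \<times> ?R \<times> v ` carrier G)"
      using t by (force simp: image_iff)
    then show "finite ((\<lambda>g. inv\<^bsub>E\<^esub> s g \<otimes>\<^bsub>E\<^esub> s (g \<otimes>\<^bsub>G\<^esub> t)) ` carrier G)"
      by (rule finite_subset[OF _ finite_imageI])
         (intro finite_cartesian_product finv fin)
  qed
  then show ?thesis using that by blast
qed

end

section \<open>Virtual splittings\<close>

context central_ext
begin

lemma subgroup_preimage: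
  assumes "subgroup G' G"
  shows "subgroup {h \<in> carrier E. \<pi> h \<in> G'} E"
proof -
  interpret H: subgroup G' G by fact
  show ?thesis by (rule E.subgroupI) auto
qed

text \<open>An isomorphism with the product gives a splitting by restricting its inverse to the
  second factor. Conversely, a splitting \<open>\<sigma>\<close> writes \<open>h\<close> as
  \<open>\<sigma> (\<pi> h) \<iota> (r h)\<close>, where \<open>r\<close> is multiplicative because
  \<open>\<iota>\<close> is central.\<close>

lemma virtually_trivial_iff_splits:
  "virtually_trivial Z E G \<iota> \<pi> \<longleftrightarrow>
     (\<exists>G' \<sigma>. subgroup G' G \<and> finite (rcosets\<^bsub>G\<^esub> G') \<and> \<sigma> \<in> hom (G\<lparr>carrier := G'\<rparr>) E \<and>
        (\<forall>g\<in>G'. \<pi> (\<sigma> g) = g))"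
  (is "_ \<longleftrightarrow> (\<exists>G' \<sigma>. ?splits G' \<sigma>)")
proof
  assume "virtually_trivial Z E G \<iota> \<pi>"
  then obtain G' \<Phi> where G': "subgroup G' G" "finite (rcosets\<^bsub>G\<^esub> G')"
    and \<Phi>: "\<Phi> \<in> iso (E\<lparr>carrier := {h \<in> carrier E. \<pi> h \<in> G'}\<rparr>) (Z \<times>\<times> G\<lparr>carrier := G'\<rparr>)"
      "\<And>h. h \<in> carrier E \<Longrightarrow> \<pi> h \<in> G' \<Longrightarrow> snd (\<Phi> h) = \<pi> h"
    by (auto simp: virtually_trivial_def trivial_extension_def extension_isomorphic_def)
  let ?E' = "E\<lparr>carrier := {h \<in> carrier E. \<pi> h \<in> G'}\<rparr>" and ?P = "Z \<times>\<times> G\<lparr>carrier := G'\<rparr>"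
  interpret E': group ?E' by (rule E.subgroup_imp_group[OF subgroup_preimage[OF G'(1)]])
  define \<Psi> where "\<Psi> = inv_into (carrier ?E') \<Phi>"
  have "\<Psi> \<in> iso ?P ?E'" unfolding \<Psi>_def by (rule E'.iso_set_sym[OF \<Phi>(1)])
  then have \<Psi>: "\<Psi> \<in> hom ?P ?E'" by (simp add: iso_def)
  have "\<Phi> ` carrier ?E' = carrier ?P" using \<Phi>(1) by (simp only: iso_def bij_betw_def mem_Collect_eq)
  then have \<Phi>\<Psi>: "\<Phi> (\<Psi> y) = y" if "y \<in> carrier ?P" for y
    using that unfolding \<Psi>_def by (intro f_inv_into_f) simp
  define \<sigma> where "\<sigma> g = \<Psi> (\<one>\<^bsub>Z\<^esub>, g)" for g
  have \<sigma>: "\<sigma> g \<in> carrier E" "\<pi> (\<sigma> g) \<in> G'" if "g \<in> G'" for g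
    using hom_in_carrier[OF \<Psi>, of "(\<one>\<^bsub>Z\<^esub>, g)"] that by (auto simp: \<sigma>_def)
  have "?splits G' \<sigma>"
  proof (intro conjI ballI homI)
    fix g assume g: "g \<in> G'"
    show "\<pi> (\<sigma> g) = g" using \<Phi>(2)[OF \<sigma>[OF g]] \<Phi>\<Psi>[of "(\<one>\<^bsub>Z\<^esub>, g)"] g by (simp add: \<sigma>_def)
  next
    fix g h assume "g \<in> carrier (G\<lparr>carrier := G'\<rparr>)" "h \<in> carrier (G\<lparr>carrier := G'\<rparr>)"
    then show "\<sigma> (g \<otimes>\<^bsub>G\<lparr>carrier := G'\<rparr>\<^esub> h) = \<sigma> g \<otimes>\<^bsub>E\<^esub> \<sigma> h"
      using hom_mult[OF \<Psi>, of "(\<one>\<^bsub>Z\<^esub>, g)" "(\<one>\<^bsub>Z\<^esub>, h)"] by (simp add: \<sigma>_def)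
  qed (use G' \<sigma> in auto)
  then show "\<exists>G' \<sigma>. ?splits G' \<sigma>" by blast
next
  assume "\<exists>G' \<sigma>. ?splits G' \<sigma>"
  then obtain G' \<sigma> where G': "subgroup G' G" "finite (rcosets\<^bsub>G\<^esub> G')"
    and \<sigma>: "\<sigma> \<in> hom (G\<lparr>carrier := G'\<rparr>) E" "\<And>g. g \<in> G' \<Longrightarrow> \<pi> (\<sigma> g) = g" by auto
  interpret G': subgroup G' G by (rule G'(1))
  have \<sigma>_closed: "\<sigma> g \<in> carrier E" if "g \<in> G'" for g
    using hom_in_carrier[OF \<sigma>(1)] that by simp
  have \<sigma>_mult: "\<sigma> (g \<otimes>\<^bsub>G\<^esub> h) = \<sigma> g \<otimes>\<^bsub>E\<^esub> \<sigma> h" if "g \<in> G'" "h \<in> G'" for g h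
    using hom_mult[OF \<sigma>(1), of g h] that by simp
  have \<sigma>_one: "\<sigma> \<one>\<^bsub>G\<^esub> = \<one>\<^bsub>E\<^esub>"
    using \<sigma>_mult[of "\<one>\<^bsub>G\<^esub>" "\<one>\<^bsub>G\<^esub>"] \<sigma>_closed[of "\<one>\<^bsub>G\<^esub>"] by simp
  define r where "r h = zpart (inv\<^bsub>E\<^esub> \<sigma> (\<pi> h) \<otimes>\<^bsub>E\<^esub> h)" for h
  have r: "r h \<in> carrier Z" "\<sigma> (\<pi> h) \<otimes>\<^bsub>E\<^esub> \<iota> (r h) = h" if "h \<in> carrier E" "\<pi> h \<in> G'" for h
    using that \<sigma> \<sigma>_closed zpart_kernel[of "inv\<^bsub>E\<^esub> \<sigma> (\<pi> h) \<otimes>\<^bsub>E\<^esub> h"] by (auto simp: r_def)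
  have r_eq: "r (\<sigma> g \<otimes>\<^bsub>E\<^esub> \<iota> z) = z" if "g \<in> G'" "z \<in> carrier Z" for g z
    using that \<sigma> \<sigma>_closed by (simp add: r_def)
  have r_mult: "r (h \<otimes>\<^bsub>E\<^esub> k) = r h \<otimes>\<^bsub>Z\<^esub> r k"
    if h: "h \<in> carrier E" "\<pi> h \<in> G'" and k: "k \<in> carrier E" "\<pi> k \<in> G'" for h k
  proof -
    have "h \<otimes>\<^bsub>E\<^esub> k = \<sigma> (\<pi> h) \<otimes>\<^bsub>E\<^esub> \<iota> (r h) \<otimes>\<^bsub>E\<^esub> (\<sigma> (\<pi> k) \<otimes>\<^bsub>E\<^esub> \<iota> (r k))"
      using r h k by simp
    also have "\<dots> = \<sigma> (\<pi> h) \<otimes>\<^bsub>E\<^esub> (\<iota> (r h) \<otimes>\<^bsub>E\<^esub> \<sigma> (\<pi> k)) \<otimes>\<^bsub>E\<^esub> \<iota> (r k)"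
      using r(1) h k \<sigma>_closed by (simp add: E.m_assoc)
    also have "\<iota> (r h) \<otimes>\<^bsub>E\<^esub> \<sigma> (\<pi> k) = \<sigma> (\<pi> k) \<otimes>\<^bsub>E\<^esub> \<iota> (r h)"
      using r h k \<sigma>_closed by (simp add: central)
    also have "\<sigma> (\<pi> h) \<otimes>\<^bsub>E\<^esub> (\<sigma> (\<pi> k) \<otimes>\<^bsub>E\<^esub> \<iota> (r h)) \<otimes>\<^bsub>E\<^esub> \<iota> (r k) =
        \<sigma> (\<pi> h \<otimes>\<^bsub>G\<^esub> \<pi> k) \<otimes>\<^bsub>E\<^esub> \<iota> (r h \<otimes>\<^bsub>Z\<^esub> r k)"
      using r h k \<sigma>_closed by (simp add: \<sigma>_mult E.m_assoc)
    finally show ?thesis using r_eq r h k by (simp del: i.hom_mult)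
  qed
  define \<Phi> where "\<Phi> h = (r h, \<pi> h)" for h
  let ?E' = "E\<lparr>carrier := {h \<in> carrier E. \<pi> h \<in> G'}\<rparr>" and ?P = "Z \<times>\<times> G\<lparr>carrier := G'\<rparr>"
  have "\<Phi> \<in> iso ?E' ?P"
  proof (rule isoI)
    show "\<Phi> \<in> hom ?E' ?P" by (rule homI) (auto simp: \<Phi>_def r r_mult)
    show "bij_betw \<Phi> (carrier ?E') (carrier ?P)"
      by (rule bij_betw_byWitness[of _ "\<lambda>(z, g). \<sigma> g \<otimes>\<^bsub>E\<^esub> \<iota> z"])
         (auto simp: \<Phi>_def r r_eq \<sigma> \<sigma>_closed)
  qed
  moreover have "\<Phi> (\<iota> z) = (z, \<one>\<^bsub>G\<^esub>)" if "z \<in> carrier Z" for z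
    using that r_eq[of "\<one>\<^bsub>G\<^esub>" z] by (simp add: \<Phi>_def \<sigma>_one)
  ultimately have "trivial_extension Z ?E' (G\<lparr>carrier := G'\<rparr>) \<iota> \<pi>"
    unfolding trivial_extension_def extension_isomorphic_def
    by (intro bexI[of _ \<Phi>]) (auto simp: \<Phi>_def)
  then show "virtually_trivial Z E G \<iota> \<pi>" using G' by (auto simp: virtually_trivial_def)
qed

text \<open>Write \<open>g = g' \<tau>\<close> with \<open>g'\<close> in the finite-index subgroup and \<open>\<tau>\<close> a coset representative;
  the section sends \<open>g\<close> to the splitting of \<open>g'\<close> times a fixed lift of \<open>\<tau>\<close>.\<close>

lemma coarse_section_if_virtually_trivial:
  assumes "virtually_trivial Z E G \<iota> \<pi>"
  obtains s where "coarse_section Z E G \<iota> \<pi> s"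
proof -
  obtain G' \<sigma> where G': "subgroup G' G" "finite (rcosets\<^bsub>G\<^esub> G')"
    and \<sigma>: "\<sigma> \<in> hom (G\<lparr>carrier := G'\<rparr>) E" "\<And>g. g \<in> G' \<Longrightarrow> \<pi> (\<sigma> g) = g"
    using assms virtually_trivial_iff_splits by auto
  interpret G': subgroup G' G by (rule G'(1))
  interpret \<sigma>: group_hom "G\<lparr>carrier := G'\<rparr>" E \<sigma>
    by (intro group_hom.intro group_hom_axioms.intro G.subgroup_imp_group[OF G'(1)] E.is_group \<sigma>(1))
  \<comment> \<open>The choice depends on the coset alone, so \<open>\<tau>\<close> has finite
    range.\<close>
  define \<tau> where "\<tau> g = (SOME y. y \<in> G' #>\<^bsub>G\<^esub> g)" for g
  have \<tau>_coset: "\<tau> g \<in> G' #>\<^bsub>G\<^esub> g" if "g \<in> carrier G" for g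
    unfolding \<tau>_def using G.rcos_self[OF that G'(1)] by (rule someI)
  have \<tau>: "\<tau> g \<in> carrier G" "g \<otimes>\<^bsub>G\<^esub> inv\<^bsub>G\<^esub> \<tau> g \<in> G'" if g: "g \<in> carrier G" for g
  proof -
    obtain a where a: "a \<in> G'" "\<tau> g = a \<otimes>\<^bsub>G\<^esub> g" using \<tau>_coset[OF g] by (auto simp: r_coset_def)
    then show "\<tau> g \<in> carrier G" using g by simp
    have "g \<otimes>\<^bsub>G\<^esub> inv\<^bsub>G\<^esub> \<tau> g = inv\<^bsub>G\<^esub> a" using a g by (simp add: G.inv_mult_group)
    then show "g \<otimes>\<^bsub>G\<^esub> inv\<^bsub>G\<^esub> \<tau> g \<in> G'" using a by simp
  qed
  have "\<tau> ` carrier G = (\<lambda>X. SOME y. y \<in> X) ` (rcosets\<^bsub>G\<^esub> G')"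
    by (auto simp: \<tau>_def RCOSETS_def image_iff)
  then have fin: "finite (\<tau> ` carrier G)" using G'(2) by simp
  define s where "s g = \<sigma> (g \<otimes>\<^bsub>G\<^esub> inv\<^bsub>G\<^esub> \<tau> g) \<otimes>\<^bsub>E\<^esub> lift (\<tau> g)" for g
  have \<sigma>_closed: "\<sigma> g \<in> carrier E" if "g \<in> G'" for g
    using hom_in_carrier[OF \<sigma>(1)] that by simp
  have "coarse_section Z E G \<iota> \<pi> s"
  proof (rule coarse_sectionI)
    fix g assume g: "g \<in> carrier G"
    show "s g \<in> carrier E" "\<pi> (s g) = g"
      using g \<tau>[OF g] \<sigma>_closed[OF \<tau>(2)[OF g]] by (simp_all add: s_def \<sigma>(2) G.m_assoc)
  next
    fix t assume t: "t \<in> carrier G"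
    have "inv\<^bsub>E\<^esub> s g \<otimes>\<^bsub>E\<^esub> s (g \<otimes>\<^bsub>G\<^esub> t) =
        inv\<^bsub>E\<^esub> lift (\<tau> g) \<otimes>\<^bsub>E\<^esub> \<sigma> (\<tau> g \<otimes>\<^bsub>G\<^esub> t \<otimes>\<^bsub>G\<^esub> inv\<^bsub>G\<^esub> \<tau> (g \<otimes>\<^bsub>G\<^esub> t)) \<otimes>\<^bsub>E\<^esub> lift (\<tau> (g \<otimes>\<^bsub>G\<^esub> t))"
      if g: "g \<in> carrier G" for g
    proof -
      define a where "a = g \<otimes>\<^bsub>G\<^esub> inv\<^bsub>G\<^esub> \<tau> g"
      define b where "b = g \<otimes>\<^bsub>G\<^esub> t \<otimes>\<^bsub>G\<^esub> inv\<^bsub>G\<^esub> \<tau> (g \<otimes>\<^bsub>G\<^esub> t)"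
      have gt: "g \<otimes>\<^bsub>G\<^esub> t \<in> carrier G" using g t by simp
      have ab: "a \<in> G'" "b \<in> G'" using \<tau>(2)[OF g] \<tau>(2)[OF gt] by (simp_all add: a_def b_def)
      \<comment> \<open>The unbounded parts \<open>a\<close> and \<open>b\<close> enter the
        increment only through \<open>inv a b\<close>, which is determined by \<open>t\<close> and
        two coset representatives.\<close>
      have "\<tau> g \<otimes>\<^bsub>G\<^esub> t \<otimes>\<^bsub>G\<^esub> inv\<^bsub>G\<^esub> \<tau> (g \<otimes>\<^bsub>G\<^esub> t) = inv\<^bsub>G\<^esub> a \<otimes>\<^bsub>G\<^esub> b"
        using \<tau>(1)[OF g] \<tau>(1)[OF gt] g t by (simp add: a_def b_def G.inv_mult_group G.m_assoc)
      moreover have "\<sigma> (inv\<^bsub>G\<^esub> a \<otimes>\<^bsub>G\<^esub> b) = inv\<^bsub>E\<^esub> \<sigma> a \<otimes>\<^bsub>E\<^esub> \<sigma> b"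
        using \<sigma>.hom_mult[of "inv\<^bsub>G\<^esub> a" b] \<sigma>.hom_inv[of a] ab G.m_inv_consistent[OF G'(1), of a] by simp
      ultimately show ?thesis
        using ab \<sigma>_closed \<tau>(1)[OF g] \<tau>(1)[OF gt]
        by (simp add: s_def E.inv_mult_group E.m_assoc flip: a_def b_def)
    qed
    then have "(\<lambda>g. inv\<^bsub>E\<^esub> s g \<otimes>\<^bsub>E\<^esub> s (g \<otimes>\<^bsub>G\<^esub> t)) ` carrier G \<subseteq>
        (\<lambda>(p, q). inv\<^bsub>E\<^esub> lift p \<otimes>\<^bsub>E\<^esub> \<sigma> (p \<otimes>\<^bsub>G\<^esub> t \<otimes>\<^bsub>G\<^esub> inv\<^bsub>G\<^esub> q) \<otimes>\<^bsub>E\<^esub> lift q) `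
          (\<tau> ` carrier G \<times> \<tau> ` carrier G)"
      using t by (force simp: image_iff)
    then show "finite ((\<lambda>g. inv\<^bsub>E\<^esub> s g \<otimes>\<^bsub>E\<^esub> s (g \<otimes>\<^bsub>G\<^esub> t)) ` carrier G)"
      by (rule finite_subset[OF _ finite_imageI[OF finite_cartesian_product[OF fin fin]]])
  qed
  then show ?thesis using that by blast
qed

text \<open>A virtual complement \<open>C\<close> of \<open>\<iota>\<close> carrier
  Z\<open>meets the kernel of\<close>\<pi>\<open>trivially, so\<close>\<pi>\<open>is injective on\<close>C\<open>and its inverse splits the extension over\<close>\<pi>
  \<open>C\<close>. The index stays finite because \<open>\<pi>\<close> kills the other
  factor.\<close>

lemma virtually_trivial_if_derived_disjoint:
  assumes SE: "finite_generating_set E SE"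
    and triv: "\<And>z. z \<in> carrier Z \<Longrightarrow> \<iota> z \<in> derived E (carrier E) \<Longrightarrow> z = \<one>\<^bsub>Z\<^esub>"
  shows "virtually_trivial Z E G \<iota> \<pi>"
proof -
  let ?B = "\<iota> ` carrier Z"
  have B: "subgroup ?B E" by (rule i.img_is_subgroup)
  obtain C where C: "subgroup C E" "?B \<inter> C \<subseteq> {\<one>\<^bsub>E\<^esub>}" "finite (rcosets\<^bsub>E\<^esub> (?B <#>\<^bsub>E\<^esub> C))"
    "(?B <#>\<^bsub>E\<^esub> C) \<lhd> E"
  proof (rule E.virtual_complement[OF SE B])
    show "?B \<inter> derived E (carrier E) \<subseteq> {\<one>\<^bsub>E\<^esub>}" using triv by force
  qed (auto simp: central)
  interpret C: subgroup C E by (rule C(1))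
  let ?H = "?B <#>\<^bsub>E\<^esub> C"
  interpret H: normal ?H E by (rule C(4))
  define G' where "G' = \<pi> ` C"
  have G': "subgroup G' G" unfolding G'_def by (rule p.subgroup_img_is_subgroup[OF C(1)])
  have \<pi>_coset: "G' #>\<^bsub>G\<^esub> \<pi> h = \<pi> ` (?H #>\<^bsub>E\<^esub> h)" if h: "h \<in> carrier E" for h
  proof -
    have "\<pi> ` (?H #>\<^bsub>E\<^esub> h) = (\<Union>z\<in>carrier Z. \<Union>c\<in>C. {\<pi> (\<iota> z \<otimes>\<^bsub>E\<^esub> c \<otimes>\<^bsub>E\<^esub> h)})"
      by (auto simp: r_coset_def set_mult_def)
    also have "\<dots> = (\<Union>z\<in>carrier Z. \<Union>c\<in>C. {\<pi> c \<otimes>\<^bsub>G\<^esub> \<pi> h})"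
      using h by simp
    also have "\<dots> = G' #>\<^bsub>G\<^esub> \<pi> h" using Z.one_closed by (auto simp: r_coset_def G'_def)
    finally show ?thesis by simp
  qed
  have "rcosets\<^bsub>G\<^esub> G' \<subseteq> (`) \<pi> ` (rcosets\<^bsub>E\<^esub> ?H)"
  proof
    fix X assume "X \<in> rcosets\<^bsub>G\<^esub> G'"
    then obtain g where g: "g \<in> carrier G" "X = G' #>\<^bsub>G\<^esub> g" by (auto simp: RCOSETS_def)
    then have "X = \<pi> ` (?H #>\<^bsub>E\<^esub> lift g)" using \<pi>_coset[of "lift g"] by simp
    then show "X \<in> (`) \<pi> ` (rcosets\<^bsub>E\<^esub> ?H)"
      using g E.rcosetsI[OF H.subset, of "lift g"] by auto
  qed
  then have fin: "finite (rcosets\<^bsub>G\<^esub> G')" using C(3) by (auto intro: finite_subset)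
  have inj: "c = d" if "c \<in> C" "d \<in> C" "\<pi> c = \<pi> d" for c d
  proof -
    have "inv\<^bsub>E\<^esub> c \<otimes>\<^bsub>E\<^esub> d \<in> ?B"
      using zpart_kernel[of "inv\<^bsub>E\<^esub> c \<otimes>\<^bsub>E\<^esub> d"] that by (intro image_eqI) auto
    then have "inv\<^bsub>E\<^esub> c \<otimes>\<^bsub>E\<^esub> d = \<one>\<^bsub>E\<^esub>" using C(2) that by auto
    then have "c \<otimes>\<^bsub>E\<^esub> (inv\<^bsub>E\<^esub> c \<otimes>\<^bsub>E\<^esub> d) = c" using that by simp
    then show ?thesis using that by simp
  qed
  define \<sigma> where "\<sigma> = inv_into C \<pi>"
  have \<sigma>: "\<sigma> g \<in> C" "\<pi> (\<sigma> g) = g" if "g \<in> G'" for g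
    using that by (auto simp: \<sigma>_def G'_def inv_into_into f_inv_into_f)
  have "\<sigma> (g \<otimes>\<^bsub>G\<^esub> h) = \<sigma> g \<otimes>\<^bsub>E\<^esub> \<sigma> h" if "g \<in> G'" "h \<in> G'" for g h
    using that \<sigma> subgroup.m_closed[OF G'] by (intro inj) auto
  then have "\<sigma> \<in> hom (G\<lparr>carrier := G'\<rparr>) E" by (intro homI) (use \<sigma> in auto)
  then show ?thesis unfolding virtually_trivial_iff_splits using G' fin \<sigma> by blast
qed

end

section \<open>Real-valued coordinates along the fibres\<close>

locale additive_coarse_section = coarse_section Z E G \<iota> \<pi> s
  for Z :: "('z, 'k) monoid_scheme" and E :: "('e, 'l) monoid_scheme"
    and G :: "('g, 'm) monoid_scheme" and \<iota> :: "'z \<Rightarrow> 'e" and \<pi> :: "'e \<Rightarrow> 'g"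
    and s :: "'g \<Rightarrow> 'e" +
  fixes l :: "'z \<Rightarrow> int"
  assumes additive: "\<And>x y. x \<in> carrier Z \<Longrightarrow> y \<in> carrier Z \<Longrightarrow> l (x \<otimes>\<^bsub>Z\<^esub> y) = l x + l y"
begin

lemma additive_one [simp]: "l \<one>\<^bsub>Z\<^esub> = 0"
  using additive[of "\<one>\<^bsub>Z\<^esub>" "\<one>\<^bsub>Z\<^esub>"] by simp

lemma additive_inv_mult:
  assumes "x \<in> carrier Z" "y \<in> carrier Z"
  shows "l (inv\<^bsub>Z\<^esub> x \<otimes>\<^bsub>Z\<^esub> y) = l y - l x"
  using additive[of "inv\<^bsub>Z\<^esub> x" x] additive[of "inv\<^bsub>Z\<^esub> x" y] assms by simp

lemma additive_pow: "x \<in> carrier Z \<Longrightarrow> l (x [^]\<^bsub>Z\<^esub> (n::nat)) = int n * l x"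
  by (induction n) (simp_all add: additive algebra_simps)

definition coord :: "'e \<Rightarrow> real" where
  "coord h = real_of_int (l (fibre_coord h))"

lemma coord_mult_iota:
  "h \<in> carrier E \<Longrightarrow> z \<in> carrier Z \<Longrightarrow> coord (h \<otimes>\<^bsub>E\<^esub> \<iota> z) = coord h + real_of_int (l z)"
  by (simp add: coord_def fibre_coord_mult_iota additive)

lemma coord_increment:
  assumes "h \<in> carrier E" "a \<in> carrier E"
  shows "coord (h \<otimes>\<^bsub>E\<^esub> a) - coord h =
    real_of_int (l (inv\<^bsub>Z\<^esub> fibre_coord h \<otimes>\<^bsub>Z\<^esub> fibre_coord (h \<otimes>\<^bsub>E\<^esub> a)))"
  using assms by (simp add: coord_def additive_inv_mult)

text \<open>Increments of \<open>coord\<close> descend to functions on \<open>G\<close>, so a mean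
  on \<open>G\<close> can average them although \<open>coord\<close> lives on
  \<open>E\<close>.\<close>

lemma coord_increment_eq:
  assumes "h \<in> carrier E" "a \<in> carrier E"
  shows "coord (s (\<pi> h) \<otimes>\<^bsub>E\<^esub> a) - coord (s (\<pi> h)) = coord (h \<otimes>\<^bsub>E\<^esub> a) - coord h"
  using assms by (simp add: coord_increment fibre_coord_increment)

lemma coord_increment_bounded:
  assumes "a \<in> carrier E"
  obtains B where "B \<ge> 0" "\<And>h. h \<in> carrier E \<Longrightarrow> \<bar>coord (h \<otimes>\<^bsub>E\<^esub> a) - coord h\<bar> \<le> B"
proof -
  let ?F = "(\<lambda>z. \<bar>real_of_int (l z)\<bar>) `
      (\<lambda>h. inv\<^bsub>Z\<^esub> fibre_coord h \<otimes>\<^bsub>Z\<^esub> fibre_coord (h \<otimes>\<^bsub>E\<^esub> a)) ` carrier E"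
  have "bdd_above ?F" by (intro bdd_above_finite finite_imageI finite_fibre_coord_increments assms)
  then obtain B where B: "\<And>h. h \<in> carrier E \<Longrightarrow> \<bar>coord (h \<otimes>\<^bsub>E\<^esub> a) - coord h\<bar> \<le> B"
    using assms by (auto simp: bdd_above_def coord_increment)
  have "0 \<le> \<bar>coord (\<one>\<^bsub>E\<^esub> \<otimes>\<^bsub>E\<^esub> a) - coord \<one>\<^bsub>E\<^esub>\<bar>" by simp
  also have "\<dots> \<le> B" by (rule B) simp
  finally show ?thesis using that B by blast
qed

text \<open>The bound \<open>B\<close> is uniform in the base point, so the \<open>n\<close>
  increments along the powers of \<open>a\<close> telescope.\<close>

lemma coord_pow_bound:
  assumes "h \<in> carrier E" "a \<in> carrier E"
    and B: "\<And>h. h \<in> carrier E \<Longrightarrow> \<bar>coord (h \<otimes>\<^bsub>E\<^esub> a) - coord h\<bar> \<le> B"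
  shows "\<bar>coord (h \<otimes>\<^bsub>E\<^esub> a [^]\<^bsub>E\<^esub> (n::nat)) - coord h\<bar> \<le> real n * B"
proof (induction n)
  case 0
  then show ?case using assms by simp
next
  case (Suc n)
  have "h \<otimes>\<^bsub>E\<^esub> a [^]\<^bsub>E\<^esub> Suc n = h \<otimes>\<^bsub>E\<^esub> a [^]\<^bsub>E\<^esub> n \<otimes>\<^bsub>E\<^esub> a" using assms by (simp add: E.m_assoc)
  moreover have "\<bar>coord (h \<otimes>\<^bsub>E\<^esub> a [^]\<^bsub>E\<^esub> n \<otimes>\<^bsub>E\<^esub> a) - coord (h \<otimes>\<^bsub>E\<^esub> a [^]\<^bsub>E\<^esub> n)\<bar> \<le> B"
    using assms by (intro B) simp
  ultimately show ?case using Suc by (simp add: distrib_right)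
qed

end

section \<open>Amenable quotients\<close>

lemma bounded_functions_add:
  assumes "f \<in> bounded_functions G" "g \<in> bounded_functions G"
  shows "(\<lambda>x. f x + g x) \<in> bounded_functions G"
proof -
  obtain A B where "\<forall>x\<in>carrier G. \<bar>f x\<bar> \<le> A" "\<forall>x\<in>carrier G. \<bar>g x\<bar> \<le> B"
    using assms by (auto simp: bounded_functions_def)
  then have "\<forall>x\<in>carrier G. \<bar>f x + g x\<bar> \<le> A + B" by (meson abs_triangle_ineq add_mono order_trans)
  then show ?thesis by (auto simp: bounded_functions_def)
qed

lemma bounded_functions_cmult:
  assumes "f \<in> bounded_functions G"
  shows "(\<lambda>x. c * f x) \<in> bounded_functions G"
proof -
  obtain A where "\<forall>x\<in>carrier G. \<bar>f x\<bar> \<le> A"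
    using assms by (auto simp: bounded_functions_def)
  then have "\<forall>x\<in>carrier G. \<bar>c * f x\<bar> \<le> \<bar>c\<bar> * A" by (auto simp: abs_mult intro: mult_left_mono)
  then show ?thesis by (auto simp: bounded_functions_def)
qed

text \<open>The difference vanishes on the carrier, so it and its negative are nonnegative there;
  positivity gives both inequalities.\<close>

lemma left_invariant_mean_cong:
  assumes m: "left_invariant_mean G m" and f: "f \<in> bounded_functions G" and g: "g \<in> bounded_functions G"
    and eq: "\<And>x. x \<in> carrier G \<Longrightarrow> f x = g x"
  shows "m f = m g"
proof -
  have le: "m h \<le> m k" if h: "h \<in> bounded_functions G" and k: "k \<in> bounded_functions G"
    and "\<And>x. x \<in> carrier G \<Longrightarrow> h x = k x" for h k
  proof -
    have "0 \<le> m (\<lambda>x. k x + (- 1) * h x)"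
      using m that bounded_functions_add[OF k bounded_functions_cmult[OF h, of "- 1"]]
      unfolding left_invariant_mean_def by auto
    also have "\<dots> = m k + (- 1) * m h"
      using m k h bounded_functions_cmult[OF h, of "- 1"] unfolding left_invariant_mean_def by metis
    finally show ?thesis by simp
  qed
  show ?thesis using le[OF f g] le[OF g f] eq by force
qed

text \<open>Averaging the increments of \<open>coord\<close> over \<open>G\<close> gives a homomorphism from \<open>E\<close> to the reals
  that extends \<open>l\<close>. Means are left invariant, while the increments transform by right
  translations, hence the inversion in the definition of \<open>\<Lambda>\<close>.\<close>

lemma (in additive_coarse_section) additive_zero_on_derived:
  assumes amenable: "amenable_group G"
    and z: "z \<in> carrier Z" "\<iota> z \<in> derived E (carrier E)"
  shows "l z = 0"
proof -
  obtain m where m: "left_invariant_mean G m" using amenable by (auto simp: amenable_group_def)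
  have m_add: "m (\<lambda>x. f x + g x) = m f + m g"
    if "f \<in> bounded_functions G" "g \<in> bounded_functions G" for f g
    using m that by (simp add: left_invariant_mean_def)
  have m_inv: "m (\<lambda>x. f (a \<otimes>\<^bsub>G\<^esub> x)) = m f" if "f \<in> bounded_functions G" "a \<in> carrier G" for f a
    using m that by (simp add: left_invariant_mean_def)
  have const: "(\<lambda>x. c) \<in> bounded_functions G" for c by (auto simp: bounded_functions_def)
  have m_const: "m (\<lambda>x. c) = c" for c
  proof -
    have "\<forall>f\<in>bounded_functions G. m (\<lambda>x. c * f x) = c * m f"
      using m by (simp add: left_invariant_mean_def)
    from bspec[OF this const[of 1]] have "m (\<lambda>x. c * 1) = c * m (\<lambda>x. 1)" .
    then show ?thesis using m by (simp add: left_invariant_mean_def)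
  qed
  define F where "F a x = coord (s (inv\<^bsub>G\<^esub> x) \<otimes>\<^bsub>E\<^esub> a) - coord (s (inv\<^bsub>G\<^esub> x))" for a x
  define \<Lambda> where "\<Lambda> a = m (F a)" for a
  have F: "F a \<in> bounded_functions G" if a: "a \<in> carrier E" for a
  proof -
    obtain B where "\<And>h. h \<in> carrier E \<Longrightarrow> \<bar>coord (h \<otimes>\<^bsub>E\<^esub> a) - coord h\<bar> \<le> B"
      using coord_increment_bounded[OF a] by blast
    then show ?thesis by (auto simp: bounded_functions_def F_def intro!: exI[of _ B])
  qed
  have mult: "\<Lambda> (a \<otimes>\<^bsub>E\<^esub> b) = \<Lambda> a + \<Lambda> b" if a: "a \<in> carrier E" and b: "b \<in> carrier E" for a b
  proof -
    let ?Fb = "\<lambda>x. F b (inv\<^bsub>G\<^esub> \<pi> a \<otimes>\<^bsub>G\<^esub> x)"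
    have Fb: "?Fb \<in> bounded_functions G"
    proof -
      obtain B where "\<forall>x\<in>carrier G. \<bar>F b x\<bar> \<le> B" using F[OF b] by (auto simp: bounded_functions_def)
      then have "\<forall>x\<in>carrier G. \<bar>?Fb x\<bar> \<le> B" using a by simp
      then show ?thesis by (auto simp: bounded_functions_def)
    qed
    have "F (a \<otimes>\<^bsub>E\<^esub> b) x = F a x + ?Fb x" if x: "x \<in> carrier G" for x
    proof -
      \<comment> \<open>After inversion, right translation by \<open>\<pi> a\<close> becomes left
        translation of \<open>x\<close> by \<open>inv (\<pi> a)\<close>. The two summands are then
        the increment by \<open>a\<close> and the following increment by \<open>b\<close>.\<close>
      have "\<pi> (s (inv\<^bsub>G\<^esub> x) \<otimes>\<^bsub>E\<^esub> a) = inv\<^bsub>G\<^esub> (inv\<^bsub>G\<^esub> \<pi> a \<otimes>\<^bsub>G\<^esub> x)"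
        using x a by (simp add: G.inv_mult_group)
      then have "?Fb x = coord (s (inv\<^bsub>G\<^esub> x) \<otimes>\<^bsub>E\<^esub> a \<otimes>\<^bsub>E\<^esub> b) - coord (s (inv\<^bsub>G\<^esub> x) \<otimes>\<^bsub>E\<^esub> a)"
        using coord_increment_eq[of "s (inv\<^bsub>G\<^esub> x) \<otimes>\<^bsub>E\<^esub> a" b] x a b by (simp add: F_def)
      then show ?thesis using x a b by (simp add: F_def E.m_assoc)
    qed
    then have "\<Lambda> (a \<otimes>\<^bsub>E\<^esub> b) = m (\<lambda>x. F a x + ?Fb x)"
      unfolding \<Lambda>_def using F a b Fb
      by (intro left_invariant_mean_cong[OF m] bounded_functions_add) auto
    also have "\<dots> = \<Lambda> a + \<Lambda> b"
      using F a b Fb m_add[OF F[OF a] Fb] m_inv[OF F[OF b], of "inv\<^bsub>G\<^esub> \<pi> a"] by (simp add: \<Lambda>_def)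
    finally show ?thesis .
  qed
  have one: "\<Lambda> \<one>\<^bsub>E\<^esub> = 0" using mult[of "\<one>\<^bsub>E\<^esub>" "\<one>\<^bsub>E\<^esub>"] by simp
  have inv: "\<Lambda> (inv\<^bsub>E\<^esub> a) = - \<Lambda> a" if "a \<in> carrier E" for a
    using mult[of "inv\<^bsub>E\<^esub> a" a] that one by simp
  \<comment> \<open>A homomorphism to the commutative group of reals vanishes on all
    commutators.\<close>
  have "subgroup {a \<in> carrier E. \<Lambda> a = 0} E"
    by (rule E.subgroupI) (auto simp: mult one inv)
  then have "derived E (carrier E) \<subseteq> {a \<in> carrier E. \<Lambda> a = 0}"
    unfolding derived_def by (intro E.generate_subgroup_incl) (auto simp: mult inv)
  then have "\<Lambda> (\<iota> z) = 0" using z by auto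
  moreover have "\<Lambda> (\<iota> z) = m (\<lambda>x. real_of_int (l z))"
    unfolding \<Lambda>_def using z F const
    by (intro left_invariant_mean_cong[OF m]) (auto simp: F_def coord_mult_iota)
  ultimately show ?thesis by (simp add: m_const)
qed

section \<open>Commuting lifts\<close>

text \<open>Moving \<open>m\<close> letters \<open>x\<close> past \<open>n\<close> letters
  \<open>y\<close> makes \<open>m * n\<close> crossings, each leaving one central
  \<open>c\<close>.\<close>

lemma (in monoid) pow_mult_pow_central_commutator:
  assumes x: "x \<in> carrier G" and y: "y \<in> carrier G" and c: "c \<in> carrier G"
    and central: "\<And>h. h \<in> carrier G \<Longrightarrow> c \<otimes> h = h \<otimes> c" and xy: "x \<otimes> y = y \<otimes> x \<otimes> c"
  shows "x [^] (m::nat) \<otimes> y [^] (n::nat) = y [^] n \<otimes> x [^] m \<otimes> c [^] (m * n)"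
proof -
  have central_pow: "c [^] (k::nat) \<otimes> h = h \<otimes> c [^] k" if "h \<in> carrier G" for k h
    using that c
  proof (induction k)
    case (Suc k)
    then show ?case by (simp add: central m_assoc) (simp add: Suc.IH flip: m_assoc)
  qed simp
  have one: "x \<otimes> y [^] n = y [^] n \<otimes> x \<otimes> c [^] n" for n :: nat
  proof (induction n)
    case (Suc n)
    have "x \<otimes> y [^] Suc n = (x \<otimes> y [^] n) \<otimes> y" using x y by (simp add: m_assoc)
    also have "\<dots> = y [^] n \<otimes> x \<otimes> (c [^] n \<otimes> y)" using x y c by (simp add: Suc m_assoc)
    also have "c [^] n \<otimes> y = y \<otimes> c [^] n" using y by (rule central_pow)
    also have "y [^] n \<otimes> x \<otimes> (y \<otimes> c [^] n) = y [^] n \<otimes> (x \<otimes> y) \<otimes> c [^] n"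
      using x y c by (simp add: m_assoc)
    also have "\<dots> = y [^] n \<otimes> y \<otimes> x \<otimes> (c \<otimes> c [^] n)" unfolding xy using x y c by (simp add: m_assoc)
    also have "c \<otimes> c [^] n = c [^] Suc n" using c by (simp add: central)
    finally show ?case using x y c by (simp add: m_assoc)
  qed (use x in simp)
  show ?thesis
  proof (induction m)
    case (Suc m)
    have "x [^] Suc m \<otimes> y [^] n = x [^] m \<otimes> (x \<otimes> y [^] n)" using x y by (simp add: m_assoc)
    also have "\<dots> = (x [^] m \<otimes> y [^] n) \<otimes> x \<otimes> c [^] n" unfolding one using x y c by (simp add: m_assoc)
    also have "\<dots> = y [^] n \<otimes> x [^] m \<otimes> (c [^] (m * n) \<otimes> x) \<otimes> c [^] n"
      unfolding Suc using x y c by (simp add: m_assoc)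
    also have "c [^] (m * n) \<otimes> x = x \<otimes> c [^] (m * n)" using x by (rule central_pow)
    also have "y [^] n \<otimes> x [^] m \<otimes> (x \<otimes> c [^] (m * n)) \<otimes> c [^] n =
        y [^] n \<otimes> x [^] Suc m \<otimes> (c [^] (m * n) \<otimes> c [^] n)"
      using x y c by (simp add: m_assoc)
    finally show ?case using c by (simp add: nat_pow_mult add.commute)
  qed (use y in simp)
qed

text \<open>With \<open>xy = yxc\<close> the elements \<open>x\<^sup>n y\<^sup>n\<close> and \<open>y\<^sup>n x\<^sup>n\<close> differ by \<open>c\<close> to the power \<open>n\<^sup>2\<close>, but
  \<open>coord\<close> grows only linearly along words.\<close>

lemma (in additive_coarse_section) additive_commutator_zero:
  assumes x: "x \<in> carrier E" and y: "y \<in> carrier E" and z: "z \<in> carrier Z"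
    and xy: "x \<otimes>\<^bsub>E\<^esub> y = y \<otimes>\<^bsub>E\<^esub> x \<otimes>\<^bsub>E\<^esub> \<iota> z"
  shows "l z = 0"
proof (rule ccontr)
  assume "l z \<noteq> 0"
  obtain A where A0: "A \<ge> 0" and A: "\<And>h. h \<in> carrier E \<Longrightarrow> \<bar>coord (h \<otimes>\<^bsub>E\<^esub> x) - coord h\<bar> \<le> A"
    using coord_increment_bounded[OF x] by blast
  obtain B where B0: "B \<ge> 0" and B: "\<And>h. h \<in> carrier E \<Longrightarrow> \<bar>coord (h \<otimes>\<^bsub>E\<^esub> y) - coord h\<bar> \<le> B"
    using coord_increment_bounded[OF y] by blast
  \<comment> \<open>Each word has \<open>n\<close> letters \<open>x\<close> and \<open>n\<close>
    letters \<open>y\<close>, so its coordinate is within \<open>n * (A + B)\<close> of that of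
    \<open>1\<close>. The bound claimed is the resulting inequality divided by \<open>n\<close>;
    letting \<open>n\<close> grow contradicts \<open>l z \<noteq> 0\<close>.\<close>
  have "real n * \<bar>real_of_int (l z)\<bar> \<le> 2 * (A + B)" for n :: nat
  proof (cases "n = 0")
    case True
    then show ?thesis using A0 B0 by simp
  next
    case False
    let ?p = "x [^]\<^bsub>E\<^esub> n \<otimes>\<^bsub>E\<^esub> y [^]\<^bsub>E\<^esub> n" and ?q = "y [^]\<^bsub>E\<^esub> n \<otimes>\<^bsub>E\<^esub> x [^]\<^bsub>E\<^esub> n"
    have "?p = ?q \<otimes>\<^bsub>E\<^esub> \<iota> (z [^]\<^bsub>Z\<^esub> (n * n))"
      using E.pow_mult_pow_central_commutator[OF x y _ _ xy, of n n] z central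
      by (simp add: i.hom_nat_pow)
    then have "coord ?p = coord ?q + real n * real n * real_of_int (l z)"
      using x y z by (simp add: coord_mult_iota additive_pow)
    moreover have "\<bar>coord ?p - coord \<one>\<^bsub>E\<^esub>\<bar> \<le> real n * A + real n * B"
      using coord_pow_bound[OF E.one_closed x A, of n] coord_pow_bound[of "x [^]\<^bsub>E\<^esub> n" y B n] x y B
      by simp
    moreover have "\<bar>coord ?q - coord \<one>\<^bsub>E\<^esub>\<bar> \<le> real n * A + real n * B"
      using coord_pow_bound[OF E.one_closed y B, of n] coord_pow_bound[of "y [^]\<^bsub>E\<^esub> n" x A n] x y A
      by simp
    ultimately have "\<bar>real n * real n * real_of_int (l z)\<bar> \<le> real n * (2 * (A + B))"
      by (simp add: algebra_simps)
    then have "real n * (real n * \<bar>real_of_int (l z)\<bar>) \<le> real n * (2 * (A + B))"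
      by (simp add: abs_mult)
    then show ?thesis using False by (simp add: mult_le_cancel_left)
  qed
  moreover obtain n :: nat where "2 * (A + B) < real n * \<bar>real_of_int (l z)\<bar>"
    using reals_Archimedean3[of "\<bar>real_of_int (l z)\<bar>"] \<open>l z \<noteq> 0\<close> by auto
  ultimately show False by (meson not_le)
qed

section \<open>Detecting central elements by additive functions\<close>

context coarse_section
begin

lemma derived_disjoint_if_amenable:
  assumes "amenable_group G" "finite_generating_set Z S" "torsion_free_group Z"
    and z: "z \<in> carrier Z" "\<iota> z \<in> derived E (carrier E)"
  shows "z = \<one>\<^bsub>Z\<^esub>"
proof (rule ccontr)
  assume "z \<noteq> \<one>\<^bsub>Z\<^esub>"
  then obtain l :: "'z \<Rightarrow> int" where l: "\<And>x y. x \<in> carrier Z \<Longrightarrow> y \<in> carrier Z \<Longrightarrow> l (x \<otimes>\<^bsub>Z\<^esub> y) = l x + l y"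
    "l z \<noteq> 0"
    using Z.additive_int_function_nonzero[OF assms(2,3) z(1)] by blast
  interpret additive_coarse_section Z E G \<iota> \<pi> s l by unfold_locales (rule l(1))
  show False using additive_zero_on_derived[OF assms(1) z] l(2) by simp
qed

text \<open>The two products lie over the same element of \<open>G\<close>, hence differ by some
  \<open>\<iota> z\<close>, and every integer-valued additive function vanishes at
  \<open>z\<close>.\<close>

lemma lifts_commute:
  assumes "finite_generating_set Z S" "torsion_free_group Z"
    and x: "x \<in> carrier E" and y: "y \<in> carrier E" and comm: "\<pi> x \<otimes>\<^bsub>G\<^esub> \<pi> y = \<pi> y \<otimes>\<^bsub>G\<^esub> \<pi> x"
  shows "x \<otimes>\<^bsub>E\<^esub> y = y \<otimes>\<^bsub>E\<^esub> x"
proof -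
  define z where "z = zpart (inv\<^bsub>E\<^esub> (y \<otimes>\<^bsub>E\<^esub> x) \<otimes>\<^bsub>E\<^esub> (x \<otimes>\<^bsub>E\<^esub> y))"
  have z: "z \<in> carrier Z" "\<iota> z = inv\<^bsub>E\<^esub> (y \<otimes>\<^bsub>E\<^esub> x) \<otimes>\<^bsub>E\<^esub> (x \<otimes>\<^bsub>E\<^esub> y)"
    using zpart_kernel[of "inv\<^bsub>E\<^esub> (y \<otimes>\<^bsub>E\<^esub> x) \<otimes>\<^bsub>E\<^esub> (x \<otimes>\<^bsub>E\<^esub> y)"] x y comm by (auto simp: z_def)
  then have xy: "x \<otimes>\<^bsub>E\<^esub> y = y \<otimes>\<^bsub>E\<^esub> x \<otimes>\<^bsub>E\<^esub> \<iota> z" using x y by simp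
  have "z = \<one>\<^bsub>Z\<^esub>"
  proof (rule ccontr)
    assume "z \<noteq> \<one>\<^bsub>Z\<^esub>"
    then obtain l :: "'z \<Rightarrow> int" where l: "\<And>x y. x \<in> carrier Z \<Longrightarrow> y \<in> carrier Z \<Longrightarrow> l (x \<otimes>\<^bsub>Z\<^esub> y) = l x + l y"
      "l z \<noteq> 0"
      using Z.additive_int_function_nonzero[OF assms(1,2) z(1)] by blast
    interpret additive_coarse_section Z E G \<iota> \<pi> s l by unfold_locales (rule l(1))
    show False using additive_commutator_zero[OF x y z(1) xy] l(2) by simp
  qed
  then show ?thesis using xy x y by simp
qed

end

section \<open>Homomorphisms out of presented groups\<close>

fun letter_value :: "('a, 'm) monoid_scheme \<Rightarrow> ('v \<Rightarrow> 'a) \<Rightarrow> 'v \<times> bool \<Rightarrow> 'a" where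
  "letter_value H L (x, b) = (if b then L x else inv\<^bsub>H\<^esub> L x)"

definition gword_value :: "('a, 'm) monoid_scheme \<Rightarrow> ('v \<Rightarrow> 'a) \<Rightarrow> 'v gword \<Rightarrow> 'a" where
  "gword_value H L w = foldr (\<lambda>a y. letter_value H L a \<otimes>\<^bsub>H\<^esub> y) w \<one>\<^bsub>H\<^esub>"

lemma gword_value_simps [simp]:
  "gword_value H L [] = \<one>\<^bsub>H\<^esub>"
  "gword_value H L (a # w) = letter_value H L a \<otimes>\<^bsub>H\<^esub> gword_value H L w"
  by (simp_all add: gword_value_def)

lemma gwords_simps [simp]:
  "[] \<in> gwords V" "(x, b) # w \<in> gwords V \<longleftrightarrow> x \<in> V \<and> w \<in> gwords V"
  by (auto simp: gwords_def)

context group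
begin

lemma gword_value_closed:
  assumes "L \<in> V \<rightarrow> carrier G" "w \<in> gwords V"
  shows "gword_value G L w \<in> carrier G"
  using assms(2)
proof (induction w)
  case (Cons a w)
  then show ?case using assms(1) by (cases a) auto
qed simp

lemma gword_value_append:
  assumes L: "L \<in> V \<rightarrow> carrier G" and "u \<in> gwords V" "w \<in> gwords V"
  shows "gword_value G L (u @ w) = gword_value G L u \<otimes> gword_value G L w"
  using assms(2)
proof (induction u)
  case (Cons a u)
  obtain x b where a: "a = (x, b)" by force
  with Cons have u: "x \<in> V" "u \<in> gwords V" by auto
  then have "L x \<in> carrier G" using L by auto
  with Cons.IH[OF u(2)] show ?case
    using gword_value_closed[OF L u(2)] gword_value_closed[OF L assms(3)] by (simp add: a m_assoc)
qed (simp add: gword_value_closed[OF L assms(3)])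

lemma gword_value_word_step:
  assumes L: "L \<in> V \<rightarrow> carrier G" and R: "\<And>r. r \<in> R \<Longrightarrow> r \<in> gwords V \<and> gword_value G L r = \<one>"
    and "word_step V R u w"
  shows "gword_value G L u = gword_value G L w"
  using assms(3)
proof cases
  case (cancel v w' x b)
  then have "L x \<in> carrier G" using L by auto
  with cancel show ?thesis
    using gword_value_closed[OF L cancel(3)] gword_value_closed[OF L cancel(4)]
    by (cases b) (simp_all add: gword_value_append[OF L])
next
  case (relator v w' r)
  then show ?thesis
    using R[of r] gword_value_closed[OF L relator(3)] gword_value_closed[OF L relator(4)]
    by (simp add: gword_value_append[OF L])
qed

lemma gword_value_word_rel:
  assumes L: "L \<in> V \<rightarrow> carrier G" and R: "\<And>r. r \<in> R \<Longrightarrow> r \<in> gwords V \<and> gword_value G L r = \<one>"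
    and uw: "(u, w) \<in> word_rel V R"
  shows "gword_value G L u = gword_value G L w"
proof -
  have "equivclp (word_step V R) u w" using uw by (simp add: word_rel_def)
  then show ?thesis
  proof (induction rule: equivclp_induct)
    case (step y z)
    then show ?case using gword_value_word_step[OF L R] by metis
  qed simp
qed

text \<open>This is von Dyck's theorem. Evaluating an arbitrary representative is harmless because
  evaluation is constant on classes.\<close>

lemma presented_group_universal:
  assumes L: "L \<in> V \<rightarrow> carrier G" and R: "\<And>r. r \<in> R \<Longrightarrow> r \<in> gwords V \<and> gword_value G L r = \<one>"
  obtains \<phi> where "\<phi> \<in> hom (presented_group V R) G"
    "\<And>w. w \<in> gwords V \<Longrightarrow> \<phi> (word_rel V R `` {w}) = gword_value G L w"
proof -
  define \<phi> where "\<phi> A = gword_value G L (SOME w. w \<in> A)" for A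
  have \<phi>: "\<phi> (word_rel V R `` {w}) = gword_value G L w" if w: "w \<in> gwords V" for w
  proof -
    have "w \<in> word_rel V R `` {w}" using equiv_class_self[OF equiv_word_rel w] .
    then have "(SOME u. u \<in> word_rel V R `` {w}) \<in> word_rel V R `` {w}" by (rule someI)
    then have "(w, SOME u. u \<in> word_rel V R `` {w}) \<in> word_rel V R" by simp
    from gword_value_word_rel[OF L R this] show ?thesis by (simp add: \<phi>_def)
  qed
  have "\<phi> \<in> hom (presented_group V R) G"
  proof (rule homI)
    fix A assume "A \<in> carrier (presented_group V R)"
    then obtain u where u: "u \<in> gwords V" "A = word_rel V R `` {u}"
      by (auto simp: presented_group_def quotient_def)
    then show "\<phi> A \<in> carrier G" using \<phi> gword_value_closed[OF L] by simp
    fix B assume "B \<in> carrier (presented_group V R)"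
    then obtain w where w: "w \<in> gwords V" "B = word_rel V R `` {w}"
      by (auto simp: presented_group_def quotient_def)
    show "\<phi> (A \<otimes>\<^bsub>presented_group V R\<^esub> B) = \<phi> A \<otimes> \<phi> B"
      using u w by (simp add: presented_group_mult \<phi> gword_value_append[OF L])
  qed
  then show ?thesis using that \<phi> by blast
qed

text \<open>An isomorphism with a right-angled Artin group comes as an abstract map; this recovers
  it as evaluation at the images of the generators.\<close>

lemma hom_presented_group_eq_gword_value:
  assumes h: "h \<in> hom (presented_group V R) G" and w: "w \<in> gwords V"
  shows "h (word_rel V R `` {w}) = gword_value G (\<lambda>x. h (word_rel V R `` {[(x, True)]})) w"
proof -
  let ?P = "presented_group V R" and ?c = "\<lambda>w. word_rel V R `` {w}"
  interpret h: group_hom ?P G h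
    by (intro group_hom.intro group_hom_axioms.intro group_presented_group is_group h)
  have one: "\<one>\<^bsub>?P\<^esub> = ?c []" by (simp add: presented_group_def)
  have closed: "?c w \<in> carrier ?P" if "w \<in> gwords V" for w
    using that by (auto simp: presented_group_def quotient_def)
  show ?thesis using w
  proof (induction w)
    case Nil
    then show ?case using h.hom_one by (simp add: one)
  next
    case (Cons a w)
    obtain x b where a: "a = (x, b)" by force
    with Cons have w: "x \<in> V" "w \<in> gwords V" by auto
    have "?c [(x, False)] \<otimes>\<^bsub>?P\<^esub> ?c [(x, True)] = ?c [(x, False), (x, True)]"
      using w by (subst presented_group_mult) auto
    also have "\<dots> = \<one>\<^bsub>?P\<^esub>"
      using equiv_class_eq[OF equiv_word_rel word_inverse[of "[(x, True)]" V R]] w by (simp add: one)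
    finally have "?c [(x, False)] = inv\<^bsub>?P\<^esub> ?c [(x, True)]"
      using w closed h.G.inv_equality[of "?c [(x, False)]" "?c [(x, True)]"] by simp
    then have "h (?c [(x, b)]) = letter_value G (\<lambda>x. h (?c [(x, True)])) (x, b)"
      using w closed by simp
    moreover have "?c (a # w) = ?c [(x, b)] \<otimes>\<^bsub>?P\<^esub> ?c w"
      using w presented_group_mult[of "[(x, b)]" V w R] by (simp add: a)
    ultimately show ?case using Cons.IH[OF w(2)] w closed by (simp add: a)
  qed
qed

end

lemma (in group_hom) hom_gword_value:
  assumes L: "L \<in> V \<rightarrow> carrier G" and "w \<in> gwords V"
  shows "h (gword_value G L w) = gword_value H (\<lambda>x. h (L x)) w"
  using assms(2)
proof (induction w)
  case (Cons a w)
  obtain x b where a: "a = (x, b)" by force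
  with Cons have w: "x \<in> V" "w \<in> gwords V" by auto
  then have "L x \<in> carrier G" using L by auto
  then show ?case using Cons.IH[OF w(2)] G.gword_value_closed[OF L w(2)] by (simp add: a)
qed simp

section \<open>Right-angled Artin quotients\<close>

text \<open>The only relations to lift are commutations of generators, and
  \<open>lifts_commute\<close> makes any choice of lifts satisfy them. Hence the generators can be
  lifted independently of each other.\<close>

lemma (in coarse_section) virtually_trivial_if_raag:
  assumes S: "finite_generating_set Z S" and tf: "torsion_free_group Z"
    and graph: "simplicial_graph V Ed" and iso: "G \<cong> raag V Ed"
  shows "virtually_trivial Z E G \<iota> \<pi>"
proof -
  let ?R = "raag_relators Ed" and ?c = "\<lambda>w. word_rel V (raag_relators Ed) `` {w}"
  obtain f where f: "f \<in> iso G (raag V Ed)" using iso by (auto simp: is_iso_def)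
  define k where "k = inv_into (carrier G) f"
  have k: "k \<in> hom (presented_group V ?R) G"
    using G.iso_set_sym[OF f] by (simp add: k_def iso_def raag_def)
  have kf: "k (f g) = g" if "g \<in> carrier G" for g
    using f that by (simp add: k_def iso_def bij_betw_def)
  have f_hom: "f \<in> hom G (presented_group V ?R)" using f by (simp add: iso_def raag_def)
  have closed: "?c w \<in> carrier (presented_group V ?R)" if "w \<in> gwords V" for w
    using that by (auto simp: presented_group_def quotient_def)
  define M where "M = (\<lambda>x. k (?c [(x, True)]))"
  have M: "M \<in> V \<rightarrow> carrier G"
    using hom_in_carrier[OF k closed] by (auto simp: M_def)
  have k_eq: "k (?c w) = gword_value G M w" if "w \<in> gwords V" for w
    using G.hom_presented_group_eq_gword_value[OF k that] by (simp add: M_def)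
  define L where "L x = lift (M x)" for x
  have L: "L \<in> V \<rightarrow> carrier E" using M by (simp add: L_def Pi_iff)
  have "r \<in> gwords V \<and> gword_value E L r = \<one>\<^bsub>E\<^esub>" if "r \<in> ?R" for r
  proof -
    from that obtain x y where r: "r = [(x, True), (y, True), (x, False), (y, False)]" "{x, y} \<in> Ed"
      by (auto simp: raag_relators_def)
    then have xy: "x \<in> V" "y \<in> V" using graph by (auto simp: simplicial_graph_def)
    then have rV: "r \<in> gwords V" by (simp add: r)
    have c: "M x \<in> carrier G" "M y \<in> carrier G" "L x \<in> carrier E" "L y \<in> carrier E"
      using xy M L by auto
    have "word_step V ?R ([] @ r @ []) ([] @ [])" using that by (intro word_step.relator) auto
    then have "(r, []) \<in> word_rel V ?R" using rV by (simp add: word_rel_def r_into_equivclp)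
    then have "?c r = ?c []" by (rule equiv_class_eq[OF equiv_word_rel])
    \<comment> \<open>Relators die in the presented group, so the generators joined by an edge have
      commuting images in \<open>G\<close>.\<close>
    then have "gword_value G M r = \<one>\<^bsub>G\<^esub>" using k_eq[OF rV] k_eq[of "[]"] by simp
    then have "M x \<otimes>\<^bsub>G\<^esub> M y \<otimes>\<^bsub>G\<^esub> inv\<^bsub>G\<^esub> (M y \<otimes>\<^bsub>G\<^esub> M x) = \<one>\<^bsub>G\<^esub>"
      using c by (simp add: r G.inv_mult_group G.m_assoc)
    then have "M x \<otimes>\<^bsub>G\<^esub> M y = M y \<otimes>\<^bsub>G\<^esub> M x"
      using c G.inv_equality[of "M x \<otimes>\<^bsub>G\<^esub> M y" "inv\<^bsub>G\<^esub> (M y \<otimes>\<^bsub>G\<^esub> M x)"] by simp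
    then have "L x \<otimes>\<^bsub>E\<^esub> L y = L y \<otimes>\<^bsub>E\<^esub> L x"
      using c by (intro lifts_commute[OF S tf]) (simp_all add: L_def)
    then have "L x \<otimes>\<^bsub>E\<^esub> L y \<otimes>\<^bsub>E\<^esub> inv\<^bsub>E\<^esub> (L y \<otimes>\<^bsub>E\<^esub> L x) = \<one>\<^bsub>E\<^esub>" using c by simp
    then have "gword_value E L r = \<one>\<^bsub>E\<^esub>" using c by (simp add: r E.inv_mult_group E.m_assoc)
    with rV show ?thesis by simp
  qed
  then obtain \<phi> where \<phi>: "\<phi> \<in> hom (presented_group V ?R) E"
    "\<And>w. w \<in> gwords V \<Longrightarrow> \<phi> (?c w) = gword_value E L w"
    using E.presented_group_universal[OF L, of ?R] by blast
  have "\<pi> (\<phi> (f g)) = g" if g: "g \<in> carrier G" for g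
  proof -
    obtain w where w: "w \<in> gwords V" "f g = ?c w"
      using hom_in_carrier[OF f_hom g] by (auto simp: presented_group_def quotient_def)
    have "\<pi> (\<phi> (f g)) = gword_value G (\<lambda>x. \<pi> (L x)) w"
      using w \<phi>(2) p.hom_gword_value[OF L w(1)] by simp
    also have "\<dots> = gword_value G M w"
      using w(1)
    proof (induction w)
      case (Cons a w)
      obtain x b where "a = (x, b)" by force
      with Cons M show ?case by (auto simp: L_def Pi_iff)
    qed simp
    also have "\<dots> = g" using k_eq w kf[OF g] by simp
    finally show ?thesis .
  qed
  moreover have "\<phi> \<circ> f \<in> hom G E" by (rule hom_compose[OF f_hom \<phi>(1)])
  \<comment> \<open>The splitting is defined on the whole group, so the finite-index subgroup has
    index 1.\<close>
  moreover have "rcosets\<^bsub>G\<^esub> carrier G \<subseteq> {carrier G}"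
    using G.coset_join2[OF _ G.subgroup_self] by (auto simp: RCOSETS_def)
  then have "finite (rcosets\<^bsub>G\<^esub> carrier G)" by (rule finite_subset) simp
  ultimately show ?thesis
    unfolding virtually_trivial_iff_splits using G.subgroup_self
    by (intro exI[of _ "carrier G"] exI[of _ "\<phi> \<circ> f"]) (auto simp: hom_def)
qed

theorem theorem5:
  fixes Z :: "('z, 'k) monoid_scheme" and E :: "('e, 'l) monoid_scheme"
    and G :: "('g, 'm) monoid_scheme"
    and \<iota> :: "'z \<Rightarrow> 'e" and \<pi> :: "'e \<Rightarrow> 'g"
    and V :: "'v set" and Ed :: "'v set set"
    and SE :: "'e set" and SZG :: "('z \<times> 'g) set" and SG :: "'g set"
  assumes "finitely_generated_group G"
    and "amenable_group G \<or> (simplicial_graph V Ed \<and> G \<cong> raag V Ed)"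
    and "comm_group Z" and "finitely_generated_group Z" and "torsion_free_group Z"
    and "central_extension Z E G \<iota> \<pi>"
    and "finite_generating_set E SE"
    and "finite_generating_set (Z \<times>\<times> G) SZG"
    and "finite_generating_set G SG"
  shows "quasi_isometrically_trivial Z E G \<pi> SE SZG SG \<longleftrightarrow> virtually_trivial Z E G \<iota> \<pi>"
proof -
  interpret central_ext Z E G \<iota> \<pi> by (intro central_ext.intro assms(3,6))
  show ?thesis
  proof
    assume "quasi_isometrically_trivial Z E G \<pi> SE SZG SG"
    then obtain s where "coarse_section Z E G \<iota> \<pi> s"
      using coarse_section_if_quasi_isometrically_trivial assms(7-9) by blast
    then interpret coarse_section Z E G \<iota> \<pi> s .
    obtain S where S: "finite_generating_set Z S"
      using assms(4) by (auto simp: finitely_generated_group_def)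
    from assms(2) show "virtually_trivial Z E G \<iota> \<pi>"
    proof
      assume "amenable_group G"
      then show ?thesis
        using derived_disjoint_if_amenable[OF _ S assms(5)] assms(7)
        by (intro virtually_trivial_if_derived_disjoint)
    next
      assume "simplicial_graph V Ed \<and> G \<cong> raag V Ed"
      then show ?thesis using virtually_trivial_if_raag[OF S assms(5)] by blast
    qed
  next
    assume "virtually_trivial Z E G \<iota> \<pi>"
    then obtain s where "coarse_section Z E G \<iota> \<pi> s"
      by (rule coarse_section_if_virtually_trivial)
    then interpret coarse_section Z E G \<iota> \<pi> s .
    show "quasi_isometrically_trivial Z E G \<pi> SE SZG SG"
      by (rule quasi_isometrically_trivial[OF assms(7,8)])
  qed
qed

end
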